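(* Let $n_1\le n_2$, let $g(X)=\|X\|_*$ be the nuclear norm on $\mathbb{R}^{n_1\times n_2}$, and let $X_0\in\mathbb{R}^{n_1\times n_2}$ have rank $r$. The descent cone $\mathcal{D}(X_0)$ of the nuclear norm at $X_0$ is calculated by $$\mathcal{D}(X_0)=\mathcal{E}\cup(\operatorname{int}\mathcal{C}(X_0)),$$ where $\mathcal{C}(X_0)=\{W\in\mathbb{R}^{n_1\times n_2}\mid dg(X_0)(W)\le0\}$ is the critical cone and $$\mathcal{E}=\left\{W\in\mathbb{R}^{n_1\times n_2}\ \middle|\ \begin{array}{l}W=U\begin{pmatrix}A&BC&0\\C^TB^T&C&0\end{pmatrix}V^T,\ A\in\mathbb{S}^r,\ B\in\mathbb{R}^{r\times(n_1-r)},\ C\in\mathbb{S}_+^{n_1-r},\\ \operatorname{Tr}(A+C)=0,\ (U,V)\in\mathcal{O}(X_0)\end{array}\right\},$$ where $\operatorname{Tr}(A+C)$ means $\operatorname{Tr}A+\operatorname{Tr}C$. Moreover, if $X_0$ is an optimal solution of the problem $\min_{X\in\mathbb{R}^{n_1\times n_2}}\|X\|_*$ subject to $\Phi X=M_0$, where $\Phi:\mathbb{R}^{n_1\times n_2}\to\mathbb{R}^m$ is linear and $M_0\in\mathbb{R}^m$, then $$\operatorname{Ker}\Phi\cap\mathcal{D}(X_0)=\operatorname{Ker}\Phi\cap\left\{U\begin{pmatrix}A&BC&0\\C^TB^T&C&0\\0&0&0\end{pmatrix}V^T\ \middle|\ A\in\mathbb{S}^r,\ B\in\mathbb{R}^{r\times(p-r)},\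 C\in\mathbb{S}_+^{p-r},\ \operatorname{Tr}(A+C)=0\right\}$$ for any dual certificate $Y\in\Delta(X_0)=\partial\|X_0\|_*\cap\operatorname{Im}\Phi^*$, with $p=p(Y)=\#\{i\mid\sigma_i(Y)=1\}$, and any pair $(U,V)\in\mathcal{O}(X_0)\cap\mathcal{O}(Y)$.
   Context: $\mathbb{R}^{n_1\times n_2}$ carries the Frobenius inner product; $\|X\|_*$ is the sum of singular values; $\partial$ is the convex subdifferential; $\Phi^*$ is the adjoint of $\Phi$. The descent cone is $\mathcal{D}(X_0)=\operatorname{cone}\{X-X_0\mid\|X\|_*\le\|X_0\|_*\}$ (all nonnegative multiples). The directional derivative is $dg(X_0)(W)=\lim_{t\downarrow0}\frac{g(X_0+tW)-g(X_0)}{t}$. $\mathbb{S}^k$ (resp. $\mathbb{S}^k_+$) is the set of $k\times k$ symmetric (resp. symmetric positive semidefinite) matrices. $\sigma_1(X)\ge\dots\ge\sigma_{n_1}(X)\ge0$ are the singular values of $X$ in decreasing order. $\mathcal{O}(X)$ is the set of all pairs $(U,V)$ of orthogonal matrices $U\in\mathbb{R}^{n_1\times n_1}$, $V\in\mathbb{R}^{n_2\times n_2}$ with $X=U(\operatorname{Diag}\sigma(X))V^T$, where $\operatorname{Diag}\sigma(X)$ is the $n_1\times n_2$ matrix with $\sigma_1(X),\dots,\sigma_{n_1}(X)$ on the main diagonal in decreasing order and zeros elsewhere. *)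

theory Defs
  imports
    "HOL-Analysis.Analysis"
    "HOL-Computational_Algebra.Polynomial"
    "Jordan_Normal_Form.Matrix"
begin

text \<open>
  The space of real n1 x n2 matrices is \<open>real^'n2^'n1\<close>; its type-class inner product is the
  Frobenius inner product.  Blocks, whose sizes depend on ranks, are matrices of type
  \<open>real mat\<close>.  The notation that the two matrix libraries share is kept for \<open>real^'n2^'n1\<close>.
\<close>

type_synonym ('m, 'n) rmat = "real^'n^'m"

no_notation Matrix.vec_index (infixl \<open>$\<close> 100)
no_notation Matrix.scalar_prod (infix \<open>\<bullet>\<close> 70)
hide_const (open) Matrix.mat Matrix.row

text \<open>
  The index types are finite linear orders, so that rows and columns come in an order.
  \<open>pos i\<close> is the 0-based position of the index \<open>i\<close>, running through 0, ..., n - 1.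
\<close>

definition pos :: "'n::{finite,linorder} \<Rightarrow> nat" where
  "pos i = card {..<i}"

definition charpoly :: "real^'n^'n \<Rightarrow> real poly" where
  "charpoly A = det (\<chi> i j. if i = j then [:- (A $ i $ j), 1:] else [:- (A $ i $ j):])"

text \<open>
  Singular values in decreasing order: the square roots of the eigenvalues of
  \<open>X X\<^sup>T\<close>, with multiplicity.  For n1 \<open>\<le>\<close> n2 these are n1 numbers, and
  \<open>singular_values X ! i\<close> is the mathematical \<open>\<sigma>\<close> with index i + 1.
\<close>

definition singular_values :: "real^'n2^'n1 \<Rightarrow> real list" where
  "singular_values X =
     rev (sorted_list_of_multiset
       (image_mset sqrt (proots (charpoly (X ** Finite_Cartesian_Product.transpose X)))))"

definition nuclear_norm :: "real^'n2^'n1 \<Rightarrow> real" where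
  "nuclear_norm X = sum_list (singular_values X)"

definition Diag_sigma ::
    "('n1::{finite,linorder}, 'n2::{finite,linorder}) rmat \<Rightarrow> ('n1, 'n2) rmat" where
  "Diag_sigma X = (\<chi> i j. if pos i = pos j then singular_values X ! pos i else 0)"

definition ortho_pairs ::
    "('n1::{finite,linorder}, 'n2::{finite,linorder}) rmat \<Rightarrow>
     (('n1, 'n1) rmat \<times> ('n2, 'n2) rmat) set" where
  "ortho_pairs X = {(U, V). orthogonal_matrix U \<and> orthogonal_matrix V \<and>
     X = U ** Diag_sigma X ** Finite_Cartesian_Product.transpose V}"

definition descent_cone :: "real^'n2^'n1 \<Rightarrow> (real^'n2^'n1) set" where
  "descent_cone X0 = cone hull {X - X0 | X. nuclear_norm X \<le> nuclear_norm X0}"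

definition dir_deriv :: "('a::real_vector \<Rightarrow> real) \<Rightarrow> 'a \<Rightarrow> 'a \<Rightarrow> real" where
  "dir_deriv g x w = Lim (at_right 0) (\<lambda>t. (g (x + t *\<^sub>R w) - g x) / t)"

definition critical_cone :: "real^'n2^'n1 \<Rightarrow> (real^'n2^'n1) set" where
  "critical_cone X0 = {W. dir_deriv nuclear_norm X0 W \<le> 0}"

definition subdifferential :: "('a::real_inner \<Rightarrow> real) \<Rightarrow> 'a \<Rightarrow> 'a set" where
  "subdifferential g x = {y. \<forall>z. g x + y \<bullet> (z - x) \<le> g z}"

definition sym_mats :: "nat \<Rightarrow> real mat set" where
  "sym_mats k = {A \<in> carrier_mat k k. transpose_mat A = A}"

definition psd_mats :: "nat \<Rightarrow> real mat set" where
  "psd_mats k = {C \<in> sym_mats k. \<forall>x \<in> carrier_vec k. 0 \<le> scalar_prod x (C *\<^sub>v x)}"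

definition tr :: "real mat \<Rightarrow> real" where
  "tr A = (\<Sum>i<dim_row A. A $$ (i, i))"

text \<open>
  \<open>zero_pad M\<close> is the n1 x n2 matrix with \<open>M\<close> in its upper left corner and zeros elsewhere.
\<close>

definition zero_pad :: "real mat \<Rightarrow> ('n1::{finite,linorder}, 'n2::{finite,linorder}) rmat" where
  "zero_pad M = (\<chi> i j. if pos i < dim_row M \<and> pos j < dim_col M then M $$ (pos i, pos j) else 0)"

text \<open>
  With q = n1 there are no zero rows, and only the n2 - n1 last columns are padding.
\<close>

definition block_mats ::
    "nat \<Rightarrow> nat \<Rightarrow> ('n1::{finite,linorder}, 'n2::{finite,linorder}) rmat set" where
  "block_mats r q = {zero_pad (four_block_mat A (B * C) (transpose_mat C * transpose_mat B) C) | A B C.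
     A \<in> sym_mats r \<and> B \<in> carrier_mat r (q - r) \<and> C \<in> psd_mats (q - r) \<and> tr A + tr C = 0}"

definition E_set ::
    "('n1::{finite,linorder}, 'n2::{finite,linorder}) rmat \<Rightarrow> ('n1, 'n2) rmat set" where
  "E_set X0 = {U ** M ** Finite_Cartesian_Product.transpose V | M U V.
     M \<in> block_mats (rank X0) CARD('n1) \<and> (U, V) \<in> ortho_pairs X0}"

definition Ker :: "('a \<Rightarrow> 'b::zero) \<Rightarrow> 'a set" where
  "Ker \<Phi> = {W. \<Phi> W = 0}"

definition is_optimal :: "(real^'n2^'n1 \<Rightarrow> 'b) \<Rightarrow> 'b \<Rightarrow> real^'n2^'n1 \<Rightarrow> bool" where
  "is_optimal \<Phi> M0 X0 \<longleftrightarrow>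
     \<Phi> X0 = M0 \<and> (\<forall>X. \<Phi> X = M0 \<longrightarrow> nuclear_norm X0 \<le> nuclear_norm X)"

definition dual_cert_set ::
    "(real^'n2^'n1 \<Rightarrow> 'b::real_inner) \<Rightarrow> real^'n2^'n1 \<Rightarrow> (real^'n2^'n1) set" where
  "dual_cert_set \<Phi> X0 = subdifferential nuclear_norm X0 \<inter> range (adjoint \<Phi>)"

definition unit_count :: "real^'n2^'n1 \<Rightarrow> nat" where
  "unit_count Y = card {i. i < CARD('n1) \<and> singular_values Y ! i = 1}"

end

theory Submission
  imports Defs
begin

text \<open>
  The nuclear norm is the maximum of the linear functionals \<open>X \<mapsto> Z \<bullet> X\<close> over contractions \<open>Z\<close>
  (\<open>contraction_inner_le_nuclear_norm\<close>, \<open>nuclear_norm_attained\<close>); in particular it is convex.  A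
  direction \<open>W\<close> belongs to the descent cone exactly if \<open>X0 + t W\<close> has at most the norm of \<open>X0\<close> for some
  \<open>t > 0\<close>.  There are two cases.

  If some step strictly decreases the norm, then nearby directions decrease it as well, so \<open>W\<close> is
  interior to the critical cone.  Conversely, moving an interior direction slightly away from the
  direction \<open>- X0\<close> stays in the critical cone, and by convexity the original direction then descends
  (\<open>strict_descent_imp_interior_critical\<close>, \<open>interior_critical_imp_descent\<close>).

  Otherwise the norm is constant on a segment that starts at \<open>X0\<close>, and one contraction \<open>Z\<close> attains the
  norm at both of its ends.  The equality case of the duality (\<open>norming_diagonal_imp_gram\<close>) says that,
  in a suitable singular frame \<open>(U, V)\<close> of \<open>X0\<close>, the matrix \<open>X0 + t W\<close> is a positive semidefinite
  square matrix \<open>S\<close> padded with zeros, supported on the indices where \<open>Z\<close> has singular value 1.  So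
  \<open>W\<close> is, up to the factor \<open>1 / t\<close>, the difference of \<open>S\<close> and the diagonal matrix \<open>D\<close> of the singular
  values of \<open>X0\<close>, whose positive entries fill the first r places.  Outside the leading r \<open>\<times>\<close> r block \<open>W\<close>
  therefore inherits the shape of \<open>S\<close>: the lower diagonal block \<open>C\<close> is positive semidefinite, and the
  off-diagonal block has the form \<open>B C\<close> (\<open>gram_minus_diagonal_block_mats\<close>).  The nuclear norm of a
  padded positive semidefinite matrix is its trace (\<open>nuclear_norm_psd\<close>), so constancy of the norm is
  the trace condition.  Conversely, the Schur complement shows that \<open>D + t W\<close> stays positive
  semidefinite for small \<open>t\<close> if \<open>W\<close> has the block form, so the norm stays constant
  (\<open>block_mats_perturbation_psd\<close>, \<open>block_mats_imp_descent\<close>).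

  For an optimal \<open>X0\<close> no direction in \<open>Ker \<Phi>\<close> decreases the norm, and a dual certificate \<open>Y\<close> is
  orthogonal to \<open>Ker \<Phi>\<close>.  Then \<open>Y\<close> can play the role of \<open>Z\<close>, in the given frame that it shares with \<open>X0\<close>, and the
  block form shrinks to the indices where \<open>Y\<close> has singular value 1 (\<open>descent_in_kernel\<close>).

  The singular values are defined through a characteristic polynomial.  Everything above therefore
  rests on the spectral theorem, on the existence of singular value decompositions, and on the fact that
  each of them displays the same singular values (\<open>singular_values_svd\<close>).
\<close>

section \<open>Notation and matrix arithmetic\<close>

no_notation transpose_mat ("(_\<^sup>T)" [1000])

abbreviation tp :: "'a^'n^'m \<Rightarrow> 'a^'m^'n" ("_\<^sup>T" [1000] 999) where
  "A\<^sup>T \<equiv> Finite_Cartesian_Product.transpose A"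

lemma matrix_diff_ldistrib: "A ** (B - C) = A ** B - A ** (C :: 'a::ring_1^'n^'k)"
  by (simp add: matrix_matrix_mult_def Finite_Cartesian_Product.vec_eq_iff right_diff_distrib sum_subtractf)

lemma matrix_diff_rdistrib: "(A - B) ** C = A ** C - B ** (C :: 'a::ring_1^'n^'k)"
  by (simp add: matrix_matrix_mult_def Finite_Cartesian_Product.vec_eq_iff left_diff_distrib sum_subtractf)

lemma matrix_add_rdistrib: "(A + B) ** C = A ** C + B ** (C :: 'a::semiring_1^'n^'k)"
  by (simp add: matrix_matrix_mult_def Finite_Cartesian_Product.vec_eq_iff distrib_right sum.distrib)

lemma matrix_scaleR_left: "(c *\<^sub>R A) ** B = c *\<^sub>R (A ** (B :: real^'n^'k))"
  by (simp add: matrix_matrix_mult_def Finite_Cartesian_Product.vec_eq_iff sum_distrib_left mult.assoc)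

lemma matrix_scaleR_right: "A ** (c *\<^sub>R B) = c *\<^sub>R (A ** (B :: real^'n^'k))"
  by (simp add: matrix_matrix_mult_def Finite_Cartesian_Product.vec_eq_iff sum_distrib_left mult.left_commute)

section \<open>Positions in a finite linear order\<close>

lemma pos_less_iff: "pos i < pos j \<longleftrightarrow> i < (j::'n::{finite,linorder})"
proof -
  have mono: "pos a < pos b" if "a < b" for a b :: 'n
    unfolding pos_def using that by (intro psubset_card_mono) auto
  then show ?thesis
    by (metis less_asym' linorder_less_linear)
qed

lemma pos_eq_iff [simp]: "pos i = pos j \<longleftrightarrow> i = (j::'n::{finite,linorder})"
  by (metis less_irrefl linorder_less_linear pos_less_iff)

lemma pos_le_iff: "pos i \<le> pos j \<longleftrightarrow> i \<le> (j::'n::{finite,linorder})"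
  by (meson linorder_not_le pos_less_iff)

lemma pos_less_card [simp]: "pos (i::'n::{finite,linorder}) < CARD('n)"
  unfolding pos_def by (intro psubset_card_mono) auto

lemma bij_betw_pos: "bij_betw pos (UNIV::'n::{finite,linorder} set) {..<CARD('n)}"
proof -
  have "inj (pos :: 'n \<Rightarrow> nat)" by (auto simp: inj_on_def)
  moreover from this have "range (pos :: 'n \<Rightarrow> nat) = {..<CARD('n)}"
    by (intro card_subset_eq) (auto simp: card_image)
  ultimately show ?thesis by (simp add: bij_betw_def)
qed

text \<open>
  The inverse of \<open>pos\<close>.  It is meaningful only on numbers below the cardinality of the
  index type.
\<close>

definition of_pos :: "nat \<Rightarrow> 'n::{finite,linorder}" where
  "of_pos = inv_into UNIV pos"

lemma of_pos_pos [simp]: "of_pos (pos i) = i"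
  by (simp add: of_pos_def inv_into_f_f inj_on_def)

lemma pos_of_pos [simp]: "k < CARD('n) \<Longrightarrow> pos (of_pos k :: 'n::{finite,linorder}) = k"
  unfolding of_pos_def by (intro f_inv_into_f) (use bij_betw_pos[where 'n='n] in \<open>auto simp: bij_betw_def\<close>)

lemma sum_pos: "(\<Sum>i\<in>(UNIV::'n::{finite,linorder} set). f (pos i)) = (\<Sum>k<CARD('n). f k)"
  by (rule sum.reindex_bij_betw[OF bij_betw_pos])

text \<open>
  Decreasing singular values are positive exactly on an initial segment of the indices, and so is
  the set where they equal 1 if 1 bounds them.  Such a set is determined by its cardinality, which is
  how the rank and \<open>unit_count\<close> enter.
\<close>

lemma card_down_closed_pos:
  fixes S :: "'n::{finite,linorder} set"
  assumes "\<And>i j. i \<in> S \<Longrightarrow> j \<le> i \<Longrightarrow> j \<in> S"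
  shows "i \<in> S \<longleftrightarrow> pos i < card S"
proof
  assume "i \<in> S"
  then have "{..<i} \<subset> S" using assms by fastforce
  then show "pos i < card S" unfolding pos_def by (intro psubset_card_mono) auto
next
  assume *: "pos i < card S"
  show "i \<in> S"
  proof (rule ccontr)
    assume "i \<notin> S"
    then have "S \<subseteq> {..<i}" using assms by (meson lessThan_iff linorder_not_less subsetI)
    then have "card S \<le> pos i" unfolding pos_def by (intro card_mono) auto
    with * show False by simp
  qed
qed

section \<open>Diagonal matrices and orthonormal families\<close>

definition diagonal :: "('n \<Rightarrow> real) \<Rightarrow> real^'n^'n" where
  "diagonal d = (\<chi> i j. if i = j then d i else 0)"

text \<open>
  The n1 \<open>\<times>\<close> n2 matrix \<open>(I 0)\<close>.  Writing a padded matrix \<open>(S 0)\<close> as \<open>S ** J\<close> reduces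
  statements about rectangular block matrices to algebra with square matrices and the relation
  \<open>J ** J\<^sup>T = mat 1\<close>, which holds for n1 \<open>\<le>\<close> n2.
\<close>

definition rect_id :: "('n1::{finite,linorder}, 'n2::{finite,linorder}) rmat" ("J") where
  "J = (\<chi> i j. if pos i = pos j then 1 else 0)"

definition columns_of :: "('n \<Rightarrow> real^'m) \<Rightarrow> real^'n^'m" where
  "columns_of u = (\<chi> a i. u i $ a)"

lemma columns_of_nth [simp]: "columns_of u $ a $ i = u i $ a"
  by (simp add: columns_of_def)

lemma diagonal_nth [simp]: "diagonal d $ i $ j = (if i = j then d i else 0)"
  by (simp add: diagonal_def)

lemma rect_id_nth [simp]: "J $ i $ j = (if pos i = pos j then 1 else 0)"
  by (simp add: rect_id_def)

definition orthonormal_on :: "'i set \<Rightarrow> ('i \<Rightarrow> 'a::real_inner) \<Rightarrow> bool" where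
  "orthonormal_on I u \<longleftrightarrow> (\<forall>i\<in>I. \<forall>j\<in>I. u i \<bullet> u j = (if i = j then 1 else 0))"

lemma orthogonal_matrix_columns_of:
  fixes u :: "'n \<Rightarrow> real^'n"
  shows "orthogonal_matrix (columns_of u) \<longleftrightarrow> orthonormal_on UNIV u"
  unfolding orthogonal_matrix orthonormal_on_def
  by (auto simp: matrix_matrix_mult_def columns_of_def Finite_Cartesian_Product.vec_eq_iff transpose_def Finite_Cartesian_Product.mat_def inner_vec_def)

section \<open>The spectral theorem for real symmetric matrices\<close>

lemma quadratic_nonneg_imp_linear_zero:
  fixes b c :: real
  assumes "\<And>s. 0 \<le> 2 * s * b + s\<^sup>2 * c"
  shows "b = 0"
proof (rule ccontr)
  assume "b \<noteq> 0"
  define e where "e = 1 + \<bar>c\<bar>"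
  have e: "e > 0" "c < e" by (auto simp: e_def)
  \<comment> \<open>The step \<open>- b / e\<close> with \<open>e > c\<close> is short enough for the linear term to win.\<close>
  have "2 * (- b / e) * b + (- b / e)\<^sup>2 * c = b\<^sup>2 / e * (c / e - 2)"
    using e by (simp add: power2_eq_square field_simps)
  moreover have "b\<^sup>2 / e > 0" "c / e - 2 < 0" using e \<open>b \<noteq> 0\<close> by (auto simp: field_simps)
  ultimately have "2 * (- b / e) * b + (- b / e)\<^sup>2 * c < 0"
    by (simp only: mult_pos_neg)
  with assms[of "- b / e"] show False by simp
qed

lemma symmetric_inner:
  fixes A :: "real^'n^'n"
  assumes "A\<^sup>T = A"
  shows "x \<bullet> (A *v y) = (A *v x) \<bullet> y"
  using assms by (metis dot_lmul_matrix transpose_matrix_vector)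

text \<open>
  The quadratic form attains its maximum \<open>\<mu>\<close> on the unit sphere of \<open>W\<close> at some \<open>v\<close>.  Then
  \<open>\<mu> |x|\<^sup>2 - x \<bullet> A x\<close> is a nonnegative form on \<open>W\<close> that vanishes at \<open>v\<close>, so its derivative at \<open>v\<close>
  in every direction of \<open>W\<close> vanishes; since \<open>W\<close> is invariant this says \<open>A v = \<mu> v\<close>.
\<close>

lemma symmetric_eigenvector_in_subspace:
  fixes A :: "real^'n^'n"
  assumes sym: "A\<^sup>T = A" and W: "subspace W" "W \<noteq> {0}" and inv: "\<And>x. x \<in> W \<Longrightarrow> A *v x \<in> W"
  obtains v \<mu> where "v \<in> W" "norm v = 1" "A *v v = \<mu> *\<^sub>R v"
proof -
  define K where "K = W \<inter> sphere 0 1"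
  have "compact K" unfolding K_def using closed_subspace[OF W(1)] by (intro closed_Int_compact) auto
  obtain w where w: "w \<in> W" "w \<noteq> 0" using W subspace_0 by blast
  have "(1 / norm w) *\<^sub>R w \<in> K"
    using w W(1) by (auto simp: K_def subspace_scale)
  then have "K \<noteq> {}" by auto
  have "continuous_on K (\<lambda>x. x \<bullet> (A *v x))"
    by (intro continuous_intros)
  from continuous_attains_sup[OF \<open>compact K\<close> \<open>K \<noteq> {}\<close> this]
  obtain v where v: "v \<in> K" and max: "\<And>y. y \<in> K \<Longrightarrow> y \<bullet> (A *v y) \<le> v \<bullet> (A *v v)" by blast
  define \<mu> where "\<mu> = v \<bullet> (A *v v)"
  define h where "h x = \<mu> * (x \<bullet> x) - x \<bullet> (A *v x)" for x
  have vW: "v \<in> W" "norm v = 1" using v by (auto simp: K_def)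
  have h_nonneg: "0 \<le> h x" if "x \<in> W" for x
  proof (cases "x = 0")
    case False
    then have "(1 / norm x) *\<^sub>R x \<in> K"
      using that W(1) by (auto simp: K_def subspace_scale)
    from max[OF this] have "(1 / (norm x)\<^sup>2) * (x \<bullet> (A *v x)) \<le> \<mu>"
      by (simp add: \<mu>_def matrix_vector_mult_scaleR power2_eq_square)
    then have "x \<bullet> (A *v x) \<le> \<mu> * (norm x)\<^sup>2" using False by (simp add: field_simps)
    then show ?thesis by (simp add: h_def power2_norm_eq_inner)
  qed (simp add: h_def)
  have "(\<mu> *\<^sub>R v - A *v v) \<bullet> w = 0" if "w \<in> W" for w
  proof (rule quadratic_nonneg_imp_linear_zero)
    fix s :: real
    have hv: "h v = 0" using vW(2) by (simp add: h_def \<mu>_def flip: power2_norm_eq_inner)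
    have "h (v + s *\<^sub>R w) = h v + 2 * s * ((\<mu> *\<^sub>R v - A *v v) \<bullet> w) + s\<^sup>2 * h w"
      using symmetric_inner[OF sym, of v w] symmetric_inner[OF sym, of w v]
      by (simp add: h_def matrix_vector_right_distrib matrix_vector_mult_scaleR inner_add_left inner_add_right
          inner_diff_left power2_eq_square algebra_simps inner_commute)
    moreover have "v + s *\<^sub>R w \<in> W" using vW that W(1) by (simp add: subspace_add subspace_scale)
    ultimately show "0 \<le> 2 * s * ((\<mu> *\<^sub>R v - A *v v) \<bullet> w) + s\<^sup>2 * h w"
      using h_nonneg hv by fastforce
  qed
  moreover have "\<mu> *\<^sub>R v - A *v v \<in> W" using vW inv W(1) by (simp add: subspace_diff subspace_scale)
  ultimately have "(\<mu> *\<^sub>R v - A *v v) \<bullet> (\<mu> *\<^sub>R v - A *v v) = 0" by blast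
  then have "A *v v = \<mu> *\<^sub>R v" by simp
  with vW that show ?thesis by blast
qed

lemma orthonormal_set_independent:
  fixes B :: "'a::euclidean_space set"
  assumes "orthonormal_on B id"
  shows "independent B" "finite B" "card B \<le> DIM('a)"
proof -
  have "0 \<notin> B" using assms unfolding orthonormal_on_def by (metis id_apply inner_zero_left zero_neq_one)
  then show "independent B"
    by (intro pairwise_orthogonal_independent)
       (use assms in \<open>auto simp: orthonormal_on_def pairwise_def real_inner_class.orthogonal_def\<close>)
  then show "finite B" "card B \<le> DIM('a)" using independent_bound by auto
qed

lemma orthonormal_set_complete:
  fixes B :: "'a::euclidean_space set"
  assumes B: "orthonormal_on B id" and trivial: "\<And>x. (\<And>v. v \<in> B \<Longrightarrow> v \<bullet> x = 0) \<Longrightarrow> x = 0"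
  shows "card B = DIM('a)"
proof -
  have "x \<in> span B" for x
  proof -
    obtain y z where yz: "y \<in> span B" "\<And>w. w \<in> span B \<Longrightarrow> real_inner_class.orthogonal z w" "x = y + z"
      using orthogonal_subspace_decomp_exists[of B x] by metis
    have "z = 0"
      by (rule trivial) (use yz(2) in \<open>auto simp: real_inner_class.orthogonal_def inner_commute span_base\<close>)
    with yz show ?thesis by simp
  qed
  then have "span B = UNIV" by auto
  then show ?thesis
    using orthonormal_set_independent[OF B] by (metis dim_UNIV dim_eq_card_independent dim_span)
qed

text \<open>
  An orthonormal set of eigenvectors of maximal size is complete: its orthogonal complement is
  invariant under the symmetric matrix, and an eigenvector in it would enlarge the set.
\<close>

lemma symmetric_eigenbasis:
  fixes A :: "real^'n^'n"
  assumes sym: "A\<^sup>T = A"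
  obtains B where "orthonormal_on B id" "card B = CARD('n)" "\<And>v. v \<in> B \<Longrightarrow> \<exists>\<mu>. A *v v = \<mu> *\<^sub>R v"
proof -
  define P where "P B \<longleftrightarrow> orthonormal_on B id \<and> (\<forall>v\<in>B. \<exists>\<mu>. A *v v = \<mu> *\<^sub>R v)" for B
  have "P {}" by (simp add: P_def orthonormal_on_def)
  moreover have bound: "\<forall>B. P B \<longrightarrow> card B < CARD('n) + 1"
    using orthonormal_set_independent(3)[where 'a="real^'n"] by (fastforce simp: P_def)
  ultimately obtain B where B: "P B" "\<And>B'. P B' \<Longrightarrow> card B' \<le> card B"
    using ex_has_greatest_nat[of P "{}" card "CARD('n) + 1"] by blast
  define W where "W = {x. \<forall>v\<in>B. v \<bullet> x = 0}"
  have W: "subspace W"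
    by (auto simp: W_def subspace_def inner_add_right)
  have "W = {0}"
  proof (rule ccontr)
    assume "W \<noteq> {0}"
    moreover have "A *v x \<in> W" if "x \<in> W" for x
      unfolding W_def
    proof clarsimp
      fix v assume v: "v \<in> B"
      then obtain \<mu> where "A *v v = \<mu> *\<^sub>R v" using B by (auto simp: P_def)
      then show "v \<bullet> (A *v x) = 0"
        using that v by (simp add: symmetric_inner[OF sym] W_def)
    qed
    ultimately obtain v \<mu> where v: "v \<in> W" "norm v = 1" "A *v v = \<mu> *\<^sub>R v"
      using symmetric_eigenvector_in_subspace[OF sym W] by metis
    then have vv: "v \<bullet> v = 1" by (simp flip: power2_norm_eq_inner)
    then have "v \<notin> B" using v(1) by (auto simp: W_def)
    have "P (insert v B)"
      using B(1) v vv \<open>v \<notin> B\<close> by (auto simp: P_def orthonormal_on_def W_def inner_commute)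
    from B(2)[OF this] \<open>v \<notin> B\<close> orthonormal_set_independent(2)[of B] B(1) show False
      by (simp add: P_def)
  qed
  then have "card B = CARD('n)"
    using orthonormal_set_complete[of B] B(1) by (auto simp: P_def W_def)
  with B(1) that show ?thesis by (auto simp: P_def)
qed

text \<open>
  The eigenvectors are sorted by eigenvalue, so that the diagonal is decreasing along the index
  order, as the definition of \<open>ortho_pairs\<close> asks for singular values.
\<close>

lemma symmetric_spectral_decomposition:
  fixes A :: "('n::{finite,linorder}, 'n) rmat"
  assumes sym: "A\<^sup>T = A"
  obtains Q d where "orthogonal_matrix Q" "A = Q ** diagonal d ** Q\<^sup>T" "antimono d"
proof -
  obtain B where B: "orthonormal_on B id" "card B = CARD('n)" "\<And>v. v \<in> B \<Longrightarrow> \<exists>\<mu>. A *v v = \<mu> *\<^sub>R v"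
    using symmetric_eigenbasis[OF sym] by blast
  obtain xs where xs: "set xs = B" "distinct xs"
    using finite_distinct_list orthonormal_set_independent(2)[OF B(1)] by blast
  define key where "key v = - (v \<bullet> (A *v v))" for v
  define bs where "bs = sort_key key xs"
  have bs: "set bs = B" "distinct bs" "sorted (map key bs)" "length bs = CARD('n)"
    using xs B(2) distinct_card[of xs] by (auto simp: bs_def)
  define u where "u i = bs ! pos i" for i :: 'n
  define d where "d i = u i \<bullet> (A *v u i)" for i
  have uB: "u i \<in> B" for i unfolding u_def using bs(1,4) nth_mem pos_less_card by metis
  have u_inj: "u i = u j \<longleftrightarrow> i = j" for i j
    unfolding u_def using bs(2,4) by (simp add: nth_eq_iff_index_eq)
  have on: "orthonormal_on UNIV u"
    using B(1) uB u_inj by (auto simp: orthonormal_on_def)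
  have eig: "A *v u i = d i *\<^sub>R u i" for i
  proof -
    obtain \<mu> where "A *v u i = \<mu> *\<^sub>R u i" using B(3) uB by blast
    then show ?thesis using on by (simp add: d_def orthonormal_on_def)
  qed
  have "antimono d"
  proof (rule antimonoI)
    fix i j :: 'n assume "i \<le> j"
    then have "pos i \<le> pos j" by (simp add: pos_le_iff)
    then have "map key bs ! pos i \<le> map key bs ! pos j"
      using bs(3,4) by (intro sorted_nth_mono) auto
    then show "d j \<le> d i" using bs(4) by (simp add: key_def u_def d_def)
  qed
  define Q where "Q = columns_of u"
  have Q: "orthogonal_matrix Q" using on by (simp add: Q_def orthogonal_matrix_columns_of)
  have "A ** Q = Q ** diagonal d"
  proof -
    have "(A ** Q) $ a $ i = (Q ** diagonal d) $ a $ i" for a i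
    proof -
      have "(A ** Q) $ a $ i = (A *v u i) $ a"
        by (simp add: matrix_matrix_mult_def matrix_vector_mult_def Q_def columns_of_def)
      also have "\<dots> = (Q ** diagonal d) $ a $ i"
        by (simp add: eig matrix_matrix_mult_def Q_def columns_of_def diagonal_def if_distrib sum.delta cong: if_cong)
      finally show ?thesis .
    qed
    then show ?thesis unfolding Finite_Cartesian_Product.vec_eq_iff by blast
  qed
  then have "A ** (Q ** Q\<^sup>T) = Q ** diagonal d ** Q\<^sup>T" by (simp add: matrix_mul_assoc)
  then have "A = Q ** diagonal d ** Q\<^sup>T" using Q by (simp add: orthogonal_matrix_def)
  with Q \<open>antimono d\<close> that show ?thesis by blast
qed

section \<open>Existence of singular value decompositions\<close>

lemma pos_eq_pos_iff:
  fixes i :: "'n1::{finite,linorder}" and j :: "'n2::{finite,linorder}"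
  assumes "CARD('n1) \<le> CARD('n2)"
  shows "pos i = pos j \<longleftrightarrow> j = of_pos (pos i)"
proof -
  have "pos i < CARD('n2)" using pos_less_card assms by (rule less_le_trans)
  then have "pos (of_pos (pos i) :: 'n2) = pos i" by (rule pos_of_pos)
  then show ?thesis by (metis of_pos_pos)
qed

lemma rect_id_mult_nth:
  fixes A :: "real^'k^'n2::{finite,linorder}" and i :: "'n1::{finite,linorder}"
  assumes "CARD('n1) \<le> CARD('n2)"
  shows "((J :: ('n1, 'n2) rmat) ** A) $ i $ b = A $ (of_pos (pos i)) $ b"
proof -
  have "((J :: ('n1, 'n2) rmat) ** A) $ i $ b = (\<Sum>k\<in>UNIV. if k = of_pos (pos i) then A $ k $ b else 0)"
    unfolding matrix_matrix_mult_def vec_lambda_beta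
    by (rule sum.cong[OF refl]) (simp add: pos_eq_pos_iff[OF assms])
  then show ?thesis by simp
qed

lemma rect_id_mult_transpose:
  assumes "CARD('n1) \<le> CARD('n2)"
  shows "(J :: ('n1::{finite,linorder}, 'n2::{finite,linorder}) rmat) ** J\<^sup>T = mat 1"
proof -
  have "pos j = pos (of_pos (pos i) :: 'n2) \<longleftrightarrow> i = j" for i j :: 'n1
    using pos_eq_pos_iff[OF assms, of i] by (metis pos_eq_iff)
  then show ?thesis
    by (simp add: Finite_Cartesian_Product.vec_eq_iff rect_id_mult_nth[OF assms] transpose_def
        Finite_Cartesian_Product.mat_def)
qed

text \<open>
  An orthonormal basis of the orthogonal complement is distributed over the remaining indices.  The
  result is used to complete the right singular vectors that belong to nonzero singular values.
\<close>

lemma orthonormal_family_extension: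
  fixes s :: "'n \<Rightarrow> real^'n"
  assumes s: "orthonormal_on K s"
  obtains v where "orthonormal_on UNIV v" "\<And>j. j \<in> K \<Longrightarrow> v j = s j"
proof -
  have inj: "inj_on s K"
    using s unfolding orthonormal_on_def inj_on_def by (metis zero_neq_one)
  define S where "S = s ` K"
  have S: "orthonormal_on S id"
    using s inj by (auto simp: S_def orthonormal_on_def inj_on_eq_iff)
  define W where "W = {x. \<forall>v\<in>S. v \<bullet> x = 0}"
  have "subspace W" by (auto simp: W_def subspace_def inner_add_right)
  then obtain T where T: "T \<subseteq> W" "pairwise real_inner_class.orthogonal T"
    "\<And>x. x \<in> T \<Longrightarrow> norm x = 1" "span T = W"
    using orthonormal_basis_subspace by metis
  have T1: "orthonormal_on T id"
    using T(2,3) by (auto simp: orthonormal_on_def pairwise_def real_inner_class.orthogonal_def norm_eq_1)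
  have disj: "S \<inter> T = {}"
    using S T(1) unfolding W_def orthonormal_on_def by force
  have ST: "orthonormal_on (S \<union> T) id"
  proof -
    have cross: "x \<bullet> y = 0" "y \<bullet> x = 0" if "x \<in> S" "y \<in> T" for x y
      using that T(1) by (auto simp: W_def inner_commute)
    show ?thesis
      unfolding orthonormal_on_def
    proof (intro ballI)
      fix x y assume "x \<in> S \<union> T" "y \<in> S \<union> T"
      then consider "x \<in> S" "y \<in> S" | "x \<in> S" "y \<in> T" | "x \<in> T" "y \<in> S" | "x \<in> T" "y \<in> T" by blast
      then show "id x \<bullet> id y = (if x = y then 1 else 0)"
        by cases (use S T1 disj cross in \<open>auto simp: orthonormal_on_def\<close>)
    qed
  qed
  have "card (S \<union> T) = CARD('n)"
  proof -
    have "x = 0" if x: "\<And>v. v \<in> S \<union> T \<Longrightarrow> v \<bullet> x = 0" for x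
    proof -
      have "x \<in> span T" using x T(4) by (simp add: W_def)
      moreover have "real_inner_class.orthogonal x v" if "v \<in> span T" for v
        by (rule orthogonal_to_span[OF that]) (use x in \<open>auto simp: real_inner_class.orthogonal_def inner_commute\<close>)
      ultimately show "x = 0" by (metis orthogonal_self)
    qed
    then show ?thesis using orthonormal_set_complete[OF ST] by simp
  qed
  moreover have fin: "finite S" "finite T" using orthonormal_set_independent(2) S T1 by auto
  ultimately have "card T = CARD('n) - card K"
    using disj card_image[OF inj] by (simp add: card_Un_disjoint S_def)
  then have "card (UNIV - K) = card T" by (simp add: card_Diff_subset)
  then obtain h where h: "bij_betw h (UNIV - K) T"
    using fin by (metis finite_code finite_same_card_bij)
  define v where "v j = (if j \<in> K then s j else h j)" for j
  have vS: "v j \<in> S" if "j \<in> K" for j using that by (simp add: v_def S_def)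
  have vT: "v j \<in> T" if "j \<notin> K" for j using that h by (auto simp: v_def bij_betw_def)
  have v_inj: "v i = v j \<longleftrightarrow> i = j" for i j
  proof
    assume eq: "v i = v j"
    then have "i \<in> K \<longleftrightarrow> j \<in> K" using vS vT disj by (metis IntI empty_iff)
    then show "i = j"
      using eq inj h by (auto simp: v_def bij_betw_def inj_on_def split: if_splits)
  qed simp
  have "v j \<in> S \<union> T" for j using vS vT by blast
  then have "orthonormal_on UNIV v"
    using ST v_inj by (simp add: orthonormal_on_def)
  then show ?thesis by (rule that) (simp add: v_def)
qed

lemma diagonal_mult_nth: "(diagonal d ** A) $ i $ j = d i * A $ i $ j"
  by (simp add: matrix_matrix_mult_def if_distrib if_distribR sum.delta' cong: if_cong)

lemma diagonal_mult_diagonal: "diagonal a ** diagonal b = diagonal (\<lambda>i. a i * b i)"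
  by (simp add: Finite_Cartesian_Product.vec_eq_iff diagonal_mult_nth)

lemma transpose_diagonal [simp]: "(diagonal d)\<^sup>T = diagonal d"
  by (simp add: Finite_Cartesian_Product.vec_eq_iff transpose_def)

definition is_svd :: "('n1::{finite,linorder}, 'n1) rmat \<Rightarrow> ('n2::{finite,linorder}, 'n2) rmat \<Rightarrow>
    ('n1 \<Rightarrow> real) \<Rightarrow> ('n1, 'n2) rmat \<Rightarrow> bool" where
  "is_svd U V d X \<longleftrightarrow> orthogonal_matrix U \<and> orthogonal_matrix V \<and> antimono d \<and> (\<forall>i. 0 \<le> d i) \<and>
     X = U ** (diagonal d ** J) ** V\<^sup>T"

lemma is_svdD:
  assumes "is_svd U V d X"
  shows "orthogonal_matrix U" "orthogonal_matrix V" "antimono d" "\<And>i. 0 \<le> d i"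
    "X = U ** (diagonal d ** J) ** V\<^sup>T"
  using assms by (simp_all add: is_svd_def)

text \<open>
  If \<open>X X\<^sup>T = U diag(e) U\<^sup>T\<close>, then the rows of \<open>U\<^sup>T X\<close> are pairwise orthogonal with squared lengths
  \<open>e i\<close>.  Normalising the nonzero ones gives the first right singular vectors.
\<close>

lemma svd_exists:
  fixes X :: "('n1::{finite,linorder}, 'n2::{finite,linorder}) rmat"
  assumes n: "CARD('n1) \<le> CARD('n2)"
  obtains U V d where "is_svd U V d X"
proof -
  have "(X ** X\<^sup>T)\<^sup>T = X ** X\<^sup>T" by (simp add: matrix_transpose_mul)
  then obtain U e where U: "orthogonal_matrix U" "X ** X\<^sup>T = U ** diagonal e ** U\<^sup>T" "antimono e"
    using symmetric_spectral_decomposition by metis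
  define Y where "Y = U\<^sup>T ** X"
  have "Y ** Y\<^sup>T = U\<^sup>T ** (X ** X\<^sup>T) ** U"
    by (simp add: Y_def matrix_transpose_mul matrix_mul_assoc)
  also have "\<dots> = (U\<^sup>T ** U) ** diagonal e ** (U\<^sup>T ** U)" by (simp add: U(2) matrix_mul_assoc)
  finally have YY: "Y ** Y\<^sup>T = diagonal e" using U(1) by (simp add: orthogonal_matrix)
  have rows: "row i Y \<bullet> row j Y = (if i = j then e i else 0)" for i j
  proof -
    have "row i Y \<bullet> row j Y = (Y ** Y\<^sup>T) $ i $ j"
      by (simp add: matrix_matrix_mult_def Finite_Cartesian_Product.row_def transpose_def inner_vec_def)
    then show ?thesis by (simp add: YY)
  qed
  have e: "0 \<le> e i" for i using rows[of i i] by (metis inner_ge_zero)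
  define d where "d i = sqrt (e i)" for i
  define s where "s j = (1 / d (of_pos (pos j))) *\<^sub>R row (of_pos (pos j)) Y" for j :: 'n2
  \<comment> \<open>The columns that belong to nonzero singular values; the other columns of \<open>V\<close> are free.\<close>
  define K where "K = {j::'n2. \<exists>i::'n1. pos j = pos i \<and> 0 < e i}"
  have "orthonormal_on K s"
    unfolding orthonormal_on_def
  proof (intro ballI)
    fix j j' assume "j \<in> K" "j' \<in> K"
    then obtain i i' :: 'n1 where i: "pos j = pos i" "0 < e i" "pos j' = pos i'" "0 < e i'"
      unfolding K_def by blast
    then have "j = j' \<longleftrightarrow> i = i'" by (metis pos_eq_iff)
    with i show "s j \<bullet> s j' = (if j = j' then 1 else 0)"
      by (simp add: s_def rows d_def flip: power2_eq_square)
  qed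
  then obtain v where v: "orthonormal_on UNIV v" "\<And>j. j \<in> K \<Longrightarrow> v j = s j"
    using orthonormal_family_extension by blast
  define V where "V = columns_of v"
  have V: "orthogonal_matrix V" using v by (simp add: V_def orthogonal_matrix_columns_of)
  have "Y = diagonal d ** J ** V\<^sup>T"
  proof -
    have "Y $ i $ b = (diagonal d ** J ** V\<^sup>T) $ i $ b" for i b
    proof -
      define j :: 'n2 where "j = of_pos (pos i)"
      have pj: "pos i = pos j" using pos_eq_pos_iff[OF n, of i j] by (simp add: j_def)
      have "(J ** V\<^sup>T) $ i $ b = v j $ b"
        by (simp add: rect_id_mult_nth[OF n] V_def transpose_def j_def)
      then have r: "(diagonal d ** J ** V\<^sup>T) $ i $ b = d i * v j $ b"
        by (simp add: diagonal_mult_nth flip: matrix_mul_assoc)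
      show ?thesis
      proof (cases "e i = 0")
        case True
        then have "row i Y = 0" using rows[of i i] by simp
        then have "Y $ i $ b = 0" by (simp add: Finite_Cartesian_Product.row_def Finite_Cartesian_Product.vec_eq_iff)
        then show ?thesis using r True by (simp add: d_def)
      next
        case False
        then have "0 < e i" using e[of i] by simp
        then have "j \<in> K" using pj[symmetric] by (auto simp: K_def)
        then have "v j = (1 / d i) *\<^sub>R row i Y" by (simp add: v(2) s_def flip: pj)
        then show ?thesis using r False by (simp add: Finite_Cartesian_Product.row_def d_def)
      qed
    qed
    then show ?thesis unfolding Finite_Cartesian_Product.vec_eq_iff by blast
  qed
  then have "U ** Y = U ** (diagonal d ** J) ** V\<^sup>T" by (simp only: matrix_mul_assoc)
  then have "X = U ** (diagonal d ** J) ** V\<^sup>T"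
    using U(1) by (simp add: Y_def matrix_mul_assoc orthogonal_matrix_def)
  moreover have "antimono d" using U(3) by (simp add: d_def antimono_def)
  ultimately show ?thesis using that[of U V d] U(1) V e by (simp add: is_svd_def d_def)
qed

section \<open>Uniqueness of singular values\<close>

definition const_mat :: "real^'n^'m \<Rightarrow> real poly^'n^'m" where
  "const_mat A = (\<chi> i j. [:A $ i $ j:])"

lemma const_mat_mult:
  fixes A :: "real^'k^'m" and B :: "real^'n^'k"
  shows "const_mat (A ** B) = const_mat A ** const_mat B"
proof -
  have "[:\<Sum>k\<in>S. f k:] = (\<Sum>k\<in>S. [:f k:])" for f :: "'k \<Rightarrow> real" and S
  proof (induction S rule: infinite_finite_induct)
    case (insert x F)
    show ?case using insert(1,2) by (simp flip: insert(3))
  qed auto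
  then show ?thesis
    by (simp add: const_mat_def matrix_matrix_mult_def Finite_Cartesian_Product.vec_eq_iff mult.commute)
qed

lemma const_mat_id: "const_mat (mat 1) = mat 1"
  by (simp add: const_mat_def Finite_Cartesian_Product.mat_def Finite_Cartesian_Product.vec_eq_iff)

lemma charpoly_alt: "charpoly A = det (mat [:0,1:] - const_mat A)"
  unfolding charpoly_def
  by (rule arg_cong[where f = det]) (simp add: Finite_Cartesian_Product.vec_eq_iff Finite_Cartesian_Product.mat_def const_mat_def)

text \<open>
  Over the polynomial ring, \<open>x I - U A U\<^sup>T = U (x I - A) U\<^sup>T\<close>, and the determinant is
  multiplicative.
\<close>

lemma charpoly_orthogonal_conj:
  assumes "orthogonal_matrix (U :: real^'n^'n)"
  shows "charpoly (U ** A ** U\<^sup>T) = charpoly A"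
proof -
  have UU: "const_mat U ** const_mat (U\<^sup>T) = mat 1"
    using assms by (simp add: orthogonal_matrix_def const_mat_id flip: const_mat_mult)
  have scal: "mat x ** M = M ** mat x" for x and M :: "real poly^'n^'n"
  proof -
    have "(mat x ** M) $ i $ j = (\<Sum>k\<in>UNIV. if k = i then x * M $ i $ j else 0)"
      "(M ** mat x) $ i $ j = (\<Sum>k\<in>UNIV. if k = j then M $ i $ j * x else 0)" for i j
      unfolding matrix_matrix_mult_def Finite_Cartesian_Product.mat_def vec_lambda_beta
      by (rule sum.cong[OF refl], simp)+
    then have "(mat x ** M) $ i $ j = x * M $ i $ j" "(M ** mat x) $ i $ j = M $ i $ j * x" for i j
      by simp_all
    then show ?thesis unfolding Finite_Cartesian_Product.vec_eq_iff by (metis mult.commute)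
  qed
  have "const_mat U ** mat [:0,1:] ** const_mat (U\<^sup>T) = mat [:0,1:]"
    unfolding scal[of "[:0, 1:]" "const_mat U", symmetric] matrix_mul_assoc[symmetric] UU by simp
  then have "mat [:0,1:] - const_mat (U ** A ** U\<^sup>T) =
      const_mat U ** (mat [:0,1:] - const_mat A) ** const_mat (U\<^sup>T)"
    by (simp add: const_mat_mult matrix_diff_ldistrib matrix_diff_rdistrib)
  moreover have "det (const_mat U) * det (const_mat (U\<^sup>T)) = 1"
    using UU by (metis det_I det_mul)
  ultimately show ?thesis
    by (simp add: charpoly_alt det_mul mult.commute mult.left_commute)
qed

lemma proots_charpoly_diagonal:
  fixes e :: "'n::finite \<Rightarrow> real"
  shows "proots (charpoly (diagonal e)) = image_mset e (mset_set UNIV)"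
proof -
  have "charpoly (diagonal e) = (\<Prod>i\<in>UNIV. [:- e i, 1:])"
    unfolding charpoly_def by (subst det_diagonal) auto
  also have "proots \<dots> = (\<Sum>i\<in>UNIV. {#e i#})"
    by (subst proots_prod) auto
  also have "\<dots> = image_mset e (mset_set UNIV)" by (simp add: sum_unfold_sum_mset)
  finally show ?thesis .
qed

text \<open>
  \<open>X X\<^sup>T = U diag(d\<^sup>2) U\<^sup>T\<close>, so the roots of the characteristic polynomial are the squares of the
  \<open>d i\<close>, whatever decomposition is taken.  The list is already sorted because \<open>d\<close> decreases.
\<close>

lemma singular_values_svd:
  fixes X :: "('n1::{finite,linorder}, 'n2::{finite,linorder}) rmat"
  assumes n: "CARD('n1) \<le> CARD('n2)"
    and svd: "is_svd U V d X"
  shows "singular_values X = map (\<lambda>k. d (of_pos k)) [0..<CARD('n1)]"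
proof -
  note U = is_svdD(1)[OF svd] and V = is_svdD(2)[OF svd] and d = is_svdD(3,4)[OF svd] and X = is_svdD(5)[OF svd]
  have "X ** X\<^sup>T = U ** diagonal d ** (J ** (V\<^sup>T ** V) ** J\<^sup>T) ** diagonal d ** U\<^sup>T"
    unfolding X by (simp add: matrix_transpose_mul matrix_mul_assoc)
  also have "\<dots> = U ** diagonal (\<lambda>i. d i * d i) ** U\<^sup>T"
    using V by (simp add: orthogonal_matrix rect_id_mult_transpose[OF n] diagonal_mult_diagonal flip: matrix_mul_assoc)
  finally have "image_mset sqrt (proots (charpoly (X ** X\<^sup>T))) = image_mset d (mset_set UNIV)"
    using d(2) by (simp add: charpoly_orthogonal_conj[OF U] proots_charpoly_diagonal multiset.map_comp o_def)
  also have "mset_set (UNIV :: 'n1 set) = image_mset of_pos (mset_set {..<CARD('n1)})"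
  proof -
    have "inj_on (of_pos :: nat \<Rightarrow> 'n1) {..<CARD('n1)}" by (metis inj_onI lessThan_iff pos_of_pos)
    moreover have "(of_pos :: nat \<Rightarrow> 'n1) ` {..<CARD('n1)} = UNIV"
      by (metis UNIV_eq_I imageI lessThan_iff of_pos_pos pos_less_card)
    ultimately show ?thesis by (metis image_mset_mset_set)
  qed
  also have "image_mset d \<dots> = mset (map (\<lambda>k. d (of_pos k)) [0..<CARD('n1)])"
    by (simp add: multiset.map_comp o_def lessThan_atLeast0)
  also have "\<dots> = mset (rev (map (\<lambda>k. d (of_pos k)) [0..<CARD('n1)]))" by simp
  finally have "singular_values X = rev (sort (rev (map (\<lambda>k. d (of_pos k)) [0..<CARD('n1)])))"
    unfolding singular_values_def by (simp only: sorted_list_of_multiset_mset)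
  moreover have "sorted (rev (map (\<lambda>k. d (of_pos k)) [0..<CARD('n1)]))"
    unfolding sorted_rev_iff_nth_mono
  proof (intro allI impI)
    fix k l assume kl: "k \<le> l" "l < length (map (\<lambda>k. d (of_pos k)) [0..<CARD('n1)])"
    then have "(of_pos k :: 'n1) \<le> of_pos l" by (subst pos_le_iff[symmetric]) simp
    with kl show "map (\<lambda>k. d (of_pos k)) [0..<CARD('n1)] ! l \<le> map (\<lambda>k. d (of_pos k)) [0..<CARD('n1)] ! k"
      by (simp add: antimonoD[OF d(1)])
  qed
  ultimately show ?thesis by (simp add: sorted_sort_id)
qed

lemma nuclear_norm_svd:
  fixes X :: "('n1::{finite,linorder}, 'n2::{finite,linorder}) rmat"
  assumes "CARD('n1) \<le> CARD('n2)"
    and "is_svd U V d X"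
  shows "nuclear_norm X = (\<Sum>i\<in>UNIV. d i)"
proof -
  have "nuclear_norm X = (\<Sum>k<CARD('n1). d (of_pos k))"
    unfolding nuclear_norm_def singular_values_svd[OF assms]
    by (simp only: interv_sum_list_conv_sum_set_nat atLeast0LessThan set_upt)
  also have "\<dots> = (\<Sum>i\<in>UNIV. d (of_pos (pos (i::'n1))))"
    by (rule sum_pos[symmetric])
  finally show ?thesis by simp
qed

lemma Diag_sigma_svd:
  fixes X :: "('n1::{finite,linorder}, 'n2::{finite,linorder}) rmat"
  assumes "CARD('n1) \<le> CARD('n2)"
    and "is_svd U V d X"
  shows "Diag_sigma X = diagonal d ** J"
proof -
  have nth: "singular_values X ! pos i = d i" for i :: 'n1
  proof -
    have "map (\<lambda>k. d (of_pos k)) [0..<CARD('n1)] ! pos i = d (of_pos (0 + pos i))"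
      by (rule nth_map_upt) simp
    then show ?thesis by (simp only: singular_values_svd[OF assms] add_0 of_pos_pos)
  qed
  have a: "Diag_sigma X $ i $ j = (if pos i = pos j then d i else 0)" for i j
    by (simp only: Diag_sigma_def nth vec_lambda_beta)
  have b: "(diagonal d ** J) $ i $ j = (if pos i = pos j then d i else 0)" for i :: 'n1 and j :: 'n2
    by (simp add: diagonal_mult_nth)
  have "Diag_sigma X $ i $ j = (diagonal d ** J) $ i $ j" for i j
    by (simp only: a b)
  then show ?thesis by (simp only: Finite_Cartesian_Product.vec_eq_iff simp_thms)
qed

section \<open>The nuclear norm as a dual norm\<close>

lemma inner_mult_left:
  fixes A :: "real^'n^'m"
  shows "A \<bullet> (U ** B) = (U\<^sup>T ** A) \<bullet> B"
proof -
  have "A \<bullet> (U ** B) = (\<Sum>i\<in>UNIV. \<Sum>j\<in>UNIV. \<Sum>k\<in>UNIV. A $ i $ j * (U $ i $ k * B $ k $ j))"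
    by (simp add: inner_vec_def matrix_matrix_mult_def sum_distrib_left)
  also have "\<dots> = (\<Sum>j\<in>UNIV. \<Sum>i\<in>UNIV. \<Sum>k\<in>UNIV. A $ i $ j * (U $ i $ k * B $ k $ j))"
    by (rule sum.swap)
  also have "\<dots> = (\<Sum>j\<in>UNIV. \<Sum>k\<in>UNIV. \<Sum>i\<in>UNIV. A $ i $ j * (U $ i $ k * B $ k $ j))"
    by (intro sum.cong refl sum.swap)
  also have "\<dots> = (\<Sum>k\<in>UNIV. \<Sum>j\<in>UNIV. \<Sum>i\<in>UNIV. A $ i $ j * (U $ i $ k * B $ k $ j))"
    by (rule sum.swap)
  also have "\<dots> = (U\<^sup>T ** A) \<bullet> B"
    unfolding inner_vec_def matrix_matrix_mult_def transpose_def vec_lambda_beta inner_real_def sum_distrib_right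
    by (simp add: mult.commute mult.left_commute)
  finally show ?thesis .
qed

lemma inner_transpose: "(A\<^sup>T) \<bullet> (B\<^sup>T) = A \<bullet> (B :: real^'n^'m)"
  unfolding inner_vec_def transpose_def vec_lambda_beta by (rule sum.swap)

lemma inner_mult_right:
  fixes A :: "real^'n^'m"
  shows "A \<bullet> (B ** V) = (A ** V\<^sup>T) \<bullet> B"
proof -
  have "A \<bullet> (B ** V) = (A\<^sup>T) \<bullet> (V\<^sup>T ** B\<^sup>T)"
    by (subst inner_transpose[symmetric]) (simp add: matrix_transpose_mul)
  also have "\<dots> = ((A ** V\<^sup>T)\<^sup>T) \<bullet> (B\<^sup>T)"
    by (simp add: inner_mult_left matrix_transpose_mul)
  finally show ?thesis by (simp add: inner_transpose)
qed

lemma inner_orthogonal_conj: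
  fixes A B :: "real^'n2^'n1"
  assumes U: "orthogonal_matrix U" and V: "orthogonal_matrix V"
  shows "(U ** A ** V\<^sup>T) \<bullet> (U ** B ** V\<^sup>T) = A \<bullet> B"
proof -
  have "(U ** A ** V\<^sup>T) \<bullet> (U ** B ** V\<^sup>T) = ((U\<^sup>T ** U) ** A ** (V\<^sup>T ** V)) \<bullet> B"
  proof -
    have "(U ** A ** V\<^sup>T) \<bullet> (U ** B ** V\<^sup>T) = (U\<^sup>T ** (U ** A ** V\<^sup>T ** V)) \<bullet> B"
      by (subst inner_mult_right, subst inner_mult_left) simp
    then show ?thesis by (simp add: matrix_mul_assoc)
  qed
  then show ?thesis using U V by (simp add: orthogonal_matrix)
qed

lemma inner_diagonal: "A \<bullet> diagonal d = (\<Sum>i\<in>UNIV. A $ i $ i * d i)"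
  by (simp add: inner_vec_def if_distrib[of "\<lambda>x. _ * x"] cong: if_cong)

definition outer :: "real^'m \<Rightarrow> real^'n \<Rightarrow> real^'n^'m" where
  "outer u v = (\<chi> i j. u $ i * v $ j)"

lemma inner_outer: "Z \<bullet> outer u v = u \<bullet> (Z *v v)"
  by (simp add: outer_def inner_vec_def matrix_vector_mult_def sum_distrib_left mult.left_commute mult.commute)

lemma svd_outer:
  fixes U :: "('n1::{finite,linorder}, 'n1) rmat" and V :: "('n2::{finite,linorder}, 'n2) rmat"
  assumes n: "CARD('n1) \<le> CARD('n2)"
  shows "U ** (diagonal d ** J) ** V\<^sup>T =
    (\<Sum>k\<in>UNIV. d k *\<^sub>R outer (column k U) (column (of_pos (pos k)) V))"
proof -
  have "U ** (diagonal d ** J) ** V\<^sup>T = U ** (diagonal d ** (J ** V\<^sup>T))"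
    by (simp add: matrix_mul_assoc)
  moreover have "(U ** (diagonal d ** (J ** V\<^sup>T))) $ i $ j =
      (\<Sum>k\<in>UNIV. d k *\<^sub>R outer (column k U) (column (of_pos (pos k)) V)) $ i $ j" for i j
    unfolding matrix_matrix_mult_def[of U] vec_lambda_beta diagonal_mult_nth rect_id_mult_nth[OF n]
    by (simp add: outer_def column_def transpose_def mult.left_commute)
  ultimately show ?thesis unfolding Finite_Cartesian_Product.vec_eq_iff by simp
qed

definition contraction :: "real^'n^'m \<Rightarrow> bool" where
  "contraction Z \<longleftrightarrow> (\<forall>x. norm (Z *v x) \<le> norm x)"

lemma inner_matrix_vector: "x \<bullet> (A *v y) = (A\<^sup>T *v x) \<bullet> (y :: real^'n)"
  by (metis dot_lmul_matrix transpose_matrix_vector)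

lemma contraction_transpose:
  assumes "contraction (Z :: real^'n^'m)"
  shows "contraction (Z\<^sup>T)"
  unfolding contraction_def
proof
  fix x
  have "(norm (Z\<^sup>T *v x))\<^sup>2 = x \<bullet> (Z *v (Z\<^sup>T *v x))"
    unfolding power2_norm_eq_inner by (metis dot_lmul_matrix transpose_matrix_vector)
  also have "\<dots> \<le> norm x * norm (Z *v (Z\<^sup>T *v x))" by (rule norm_cauchy_schwarz)
  also have "\<dots> \<le> norm x * norm (Z\<^sup>T *v x)"
    using assms by (intro mult_left_mono) (auto simp: contraction_def)
  finally show "norm (Z\<^sup>T *v x) \<le> norm x"
    by (cases "Z\<^sup>T *v x = 0") (auto simp: power2_eq_square)
qed

lemma contraction_mult: "contraction A \<Longrightarrow> contraction B \<Longrightarrow> contraction (A ** B)"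
  unfolding contraction_def matrix_vector_mul_assoc[symmetric] by (meson order_trans)

lemma norm_isometry:
  assumes "A\<^sup>T ** A = mat 1"
  shows "norm (A *v x) = norm (x :: real^'n)"
proof -
  have "(norm (A *v x))\<^sup>2 = x \<bullet> ((A\<^sup>T ** A) *v x)"
    unfolding power2_norm_eq_inner matrix_vector_mul_assoc[symmetric] inner_matrix_vector by simp
  then show ?thesis using assms by (simp flip: power2_norm_eq_inner)
qed

lemma contraction_orthogonal: "orthogonal_matrix U \<Longrightarrow> contraction U"
  by (simp add: contraction_def norm_isometry orthogonal_matrix)

lemma diagonal_mult_vec: "(diagonal d *v x) $ i = d i * x $ i"
  by (simp add: matrix_vector_mult_def if_distrib[of "\<lambda>y. y * _"] cong: if_cong)

lemma contraction_diagonal: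
  assumes "\<And>i. 0 \<le> d i" "\<And>i. d i \<le> 1"
  shows "contraction (diagonal d)"
  unfolding contraction_def
proof
  fix x
  show "norm (diagonal d *v x) \<le> norm x"
  proof (rule norm_le_componentwise_cart)
    fix i
    show "norm ((diagonal d *v x) $ i) \<le> norm (x $ i)"
      using assms[of i] by (simp add: diagonal_mult_vec abs_mult mult_left_le_one_le)
  qed
qed

lemma contraction_rect_id:
  assumes n: "CARD('n1) \<le> CARD('n2)"
  shows "contraction (J :: ('n1::{finite,linorder}, 'n2::{finite,linorder}) rmat)"
proof -
  have "contraction ((J :: ('n1, 'n2) rmat)\<^sup>T)"
    unfolding contraction_def
    by (intro allI eq_refl norm_isometry) (simp add: rect_id_mult_transpose[OF n])
  from contraction_transpose[OF this] show ?thesis by simp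
qed

lemma norm_column_orthogonal: "orthogonal_matrix U \<Longrightarrow> norm (column k (U :: real^'n^'n)) = 1"
  by (simp add: orthogonal_matrix_orthonormal_columns)

lemma inner_contraction_le_1:
  assumes "contraction Z" "norm u = 1" "norm v = 1"
  shows "u \<bullet> (Z *v v) \<le> 1"
proof -
  have "u \<bullet> (Z *v v) \<le> norm u * norm (Z *v v)" by (rule norm_cauchy_schwarz)
  also have "\<dots> \<le> 1" using assms by (metis contraction_def mult_1)
  finally show ?thesis .
qed

text \<open>
  In the expansion of \<open>X\<close> into rank-one matrices \<open>\<sigma> u v\<^sup>T\<close>, each term contributes
  \<open>\<sigma> (u \<bullet> Z v) \<le> \<sigma>\<close>.  Together with \<open>nuclear_norm_attained\<close> this makes the nuclear norm the
  maximum of the linear functionals given by contractions, which is why it is subadditive.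
\<close>

lemma contraction_inner_le_nuclear_norm:
  fixes X :: "('n1::{finite,linorder}, 'n2::{finite,linorder}) rmat"
  assumes n: "CARD('n1) \<le> CARD('n2)" and Z: "contraction Z"
  shows "Z \<bullet> X \<le> nuclear_norm X"
proof -
  obtain U V d where svd: "is_svd U V d X"
    by (rule svd_exists[OF n, of X])
  note nuc = nuclear_norm_svd[OF n svd] and svd = is_svdD[OF svd]
  have "Z \<bullet> X = (\<Sum>k\<in>UNIV. d k * (column k U \<bullet> (Z *v column (of_pos (pos k)) V)))"
    unfolding svd(5) svd_outer[OF n] by (simp add: inner_sum_right inner_outer)
  also have "\<dots> \<le> (\<Sum>k\<in>UNIV. d k * 1)"
    by (intro sum_mono mult_left_mono svd(4) inner_contraction_le_1[OF Z] norm_column_orthogonal svd(1,2))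
  finally show ?thesis by (simp add: nuc)
qed

lemma inner_rect_id_diagonal:
  assumes n: "CARD('n1) \<le> CARD('n2)"
  shows "(diagonal c ** J) \<bullet> (diagonal d ** (J :: ('n1::{finite,linorder}, 'n2::{finite,linorder}) rmat)) = (\<Sum>i\<in>UNIV. c i * d i)"
  by (simp add: inner_mult_right rect_id_mult_transpose[OF n] inner_diagonal flip: matrix_mul_assoc)

lemma diagonal_one: "diagonal (\<lambda>_. 1) = mat 1"
  by (simp add: diagonal_def Finite_Cartesian_Product.mat_def)

lemma contraction_svd_frame:
  fixes U :: "('n1::{finite,linorder}, 'n1) rmat" and V :: "('n2::{finite,linorder}, 'n2) rmat"
  assumes n: "CARD('n1) \<le> CARD('n2)" and "orthogonal_matrix U" "orthogonal_matrix V"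
  shows "contraction (U ** J ** V\<^sup>T)"
  using assms by (intro contraction_mult contraction_orthogonal contraction_rect_id) auto

lemma nuclear_norm_attained:
  fixes X :: "('n1::{finite,linorder}, 'n2::{finite,linorder}) rmat"
  assumes n: "CARD('n1) \<le> CARD('n2)"
  obtains U V where "orthogonal_matrix U" "orthogonal_matrix V" "(U ** J ** V\<^sup>T) \<bullet> X = nuclear_norm X"
proof -
  obtain U V d where svd: "is_svd U V d X"
    by (rule svd_exists[OF n, of X])
  note nuc = nuclear_norm_svd[OF n svd] and svd = is_svdD[OF svd]
  have "(U ** J ** V\<^sup>T) \<bullet> (U ** (diagonal d ** J) ** V\<^sup>T) = (\<Sum>i\<in>UNIV. d i)"
    unfolding inner_orthogonal_conj[OF svd(1,2)]
    using inner_rect_id_diagonal[OF n, of "\<lambda>_. 1" d] by (simp add: diagonal_one)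
  then have "(U ** J ** V\<^sup>T) \<bullet> X = nuclear_norm X"
    by (simp only: svd(5)[symmetric] nuc)
  then show ?thesis by (rule that[OF svd(1,2)])
qed

lemma nuclear_norm_triangle:
  fixes X Y :: "('n1::{finite,linorder}, 'n2::{finite,linorder}) rmat"
  assumes n: "CARD('n1) \<le> CARD('n2)"
  shows "nuclear_norm (X + Y) \<le> nuclear_norm X + nuclear_norm Y"
proof -
  obtain U V where U: "orthogonal_matrix U" and V: "orthogonal_matrix V"
    and eq: "(U ** J ** V\<^sup>T) \<bullet> (X + Y) = nuclear_norm (X + Y)"
    by (rule nuclear_norm_attained[OF n, of "X + Y"])
  have "(U ** J ** V\<^sup>T) \<bullet> X \<le> nuclear_norm X" "(U ** J ** V\<^sup>T) \<bullet> Y \<le> nuclear_norm Y"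
    by (intro contraction_inner_le_nuclear_norm[OF n] contraction_svd_frame[OF n] U V)+
  then show ?thesis using eq by (simp add: inner_add_right)
qed

lemma nuclear_norm_scale:
  fixes X :: "('n1::{finite,linorder}, 'n2::{finite,linorder}) rmat"
  assumes n: "CARD('n1) \<le> CARD('n2)" and c: "0 \<le> c"
  shows "nuclear_norm (c *\<^sub>R X) = c * nuclear_norm X"
proof -
  obtain U V d where svd: "is_svd U V d X"
    by (rule svd_exists[OF n, of X])
  note nuc = nuclear_norm_svd[OF n svd] and svd = is_svdD[OF svd]
  have eq: "diagonal (\<lambda>i. c * d i) = c *\<^sub>R diagonal d"
    by (simp add: Finite_Cartesian_Product.vec_eq_iff)
  have "c *\<^sub>R X = U ** (diagonal (\<lambda>i. c * d i) ** J) ** V\<^sup>T"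
    unfolding eq svd(5) by (simp only: matrix_scaleR_right matrix_scaleR_left)
  then have "is_svd U V (\<lambda>i. c * d i) (c *\<^sub>R X)"
    using svd(1-4) c by (auto simp: is_svd_def antimono_def mult_left_mono)
  then have "nuclear_norm (c *\<^sub>R X) = (\<Sum>i\<in>UNIV. c * d i)"
    by (rule nuclear_norm_svd[OF n])
  then show ?thesis by (simp add: nuc sum_distrib_left)
qed

lemma nuclear_norm_nonneg:
  fixes X :: "('n1::{finite,linorder}, 'n2::{finite,linorder}) rmat"
  assumes n: "CARD('n1) \<le> CARD('n2)"
  shows "0 \<le> nuclear_norm X"
  using contraction_inner_le_nuclear_norm[OF n, of 0 X] by (simp add: contraction_def)

lemma nuclear_norm_0 [simp]:
  assumes n: "CARD('n1) \<le> CARD('n2)"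
  shows "nuclear_norm (0 :: ('n1::{finite,linorder}, 'n2::{finite,linorder}) rmat) = 0"
  using nuclear_norm_scale[OF n, of 0] by simp

lemma nuclear_norm_eq_0:
  fixes X :: "('n1::{finite,linorder}, 'n2::{finite,linorder}) rmat"
  assumes n: "CARD('n1) \<le> CARD('n2)" and "nuclear_norm X = 0"
  shows "X = 0"
proof -
  obtain U V d where svd: "is_svd U V d X"
    by (rule svd_exists[OF n, of X])
  note nuc = nuclear_norm_svd[OF n svd] and svd = is_svdD[OF svd]
  then have "d k = 0" for k using assms(2) by (simp add: sum_nonneg_eq_0_iff)
  then show ?thesis unfolding svd(5) svd_outer[OF n] by simp
qed

lemma nuclear_norm_orthogonal_conj:
  fixes X :: "('n1::{finite,linorder}, 'n2::{finite,linorder}) rmat"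
  assumes n: "CARD('n1) \<le> CARD('n2)" and U: "orthogonal_matrix U" and V: "orthogonal_matrix V"
  shows "nuclear_norm (U ** X ** V\<^sup>T) = nuclear_norm X"
proof -
  obtain P Q d where svd: "is_svd P Q d X"
    by (rule svd_exists[OF n, of X])
  note nuc = nuclear_norm_svd[OF n svd] and svd = is_svdD[OF svd]
  have "U ** X ** V\<^sup>T = (U ** P) ** (diagonal d ** J) ** (V ** Q)\<^sup>T"
    unfolding svd(5) by (simp only: matrix_transpose_mul matrix_mul_assoc)
  then have "is_svd (U ** P) (V ** Q) d (U ** X ** V\<^sup>T)"
    unfolding is_svd_def by (intro conjI allI svd(3,4) orthogonal_matrix_mul U V svd(1,2))
  then have "nuclear_norm (U ** X ** V\<^sup>T) = (\<Sum>i\<in>UNIV. d i)"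
    by (rule nuclear_norm_svd[OF n])
  then show ?thesis using nuc by simp
qed

lemma nuclear_norm_convex:
  assumes n: "CARD('n1) \<le> CARD('n2)"
  shows "convex_on UNIV (nuclear_norm :: ('n1::{finite,linorder}, 'n2::{finite,linorder}) rmat \<Rightarrow> real)"
proof (rule convex_onI)
  fix t :: real and x y :: "('n1, 'n2) rmat" assume "0 < t" "t < 1"
  then show "nuclear_norm ((1 - t) *\<^sub>R x + t *\<^sub>R y) \<le> (1 - t) * nuclear_norm x + t * nuclear_norm y"
    using nuclear_norm_triangle[OF n, of "(1 - t) *\<^sub>R x" "t *\<^sub>R y"] by (simp add: nuclear_norm_scale[OF n])
qed simp

section \<open>Positive semidefinite matrices and equality in the duality\<close>

text \<open>
  The block diagonal matrix with blocks \<open>Q\<close> and \<open>I\<close>.  It lets an orthogonal change of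
  coordinates on the left of \<open>J\<close> be moved to the right, by \<open>rect_id_extend\<close>.
\<close>

definition extend :: "('n1::{finite,linorder}, 'n1) rmat \<Rightarrow> ('n2::{finite,linorder}, 'n2) rmat" where
  "extend Q = J\<^sup>T ** Q ** J + (mat 1 - J\<^sup>T ** (J :: ('n1, 'n2) rmat))"

lemma transpose_diff: "(A - B)\<^sup>T = A\<^sup>T - (B :: real^'n^'m)\<^sup>T"
  by (simp add: transpose_def Finite_Cartesian_Product.vec_eq_iff)

lemma transpose_add: "(A + B)\<^sup>T = A\<^sup>T + (B :: real^'n^'m)\<^sup>T"
  by (simp add: transpose_def Finite_Cartesian_Product.vec_eq_iff)

lemma transpose_extend: "(extend Q)\<^sup>T = extend (Q\<^sup>T)"
  by (simp add: extend_def transpose_add transpose_diff matrix_transpose_mul matrix_mul_assoc)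

lemma rect_id_extend:
  fixes Q :: "('n1::{finite,linorder}, 'n1) rmat"
  assumes n: "CARD('n1) \<le> CARD('n2)"
  shows "J ** extend Q = Q ** (J :: ('n1, 'n2::{finite,linorder}) rmat)"
proof -
  let ?J = "J :: ('n1, 'n2) rmat"
  have "?J ** extend Q = (?J ** ?J\<^sup>T) ** Q ** ?J + (?J - (?J ** ?J\<^sup>T) ** ?J)"
    by (simp add: extend_def matrix_add_ldistrib matrix_diff_ldistrib matrix_mul_assoc)
  then show ?thesis by (simp add: rect_id_mult_transpose[OF n])
qed

lemma orthogonal_extend:
  fixes Q :: "('n1::{finite,linorder}, 'n1) rmat"
  assumes n: "CARD('n1) \<le> CARD('n2::{finite,linorder})" and Q: "orthogonal_matrix Q"
  shows "orthogonal_matrix (extend Q :: ('n2, 'n2) rmat)"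
proof -
  let ?J = "J :: ('n1, 'n2) rmat"
  have QQ: "Q\<^sup>T ** Q = mat 1" using Q by (simp add: orthogonal_matrix)
  have "(extend (Q\<^sup>T) :: ('n2, 'n2) rmat) ** extend Q =
      ?J\<^sup>T ** Q\<^sup>T ** (?J ** extend Q) + (extend Q - ?J\<^sup>T ** (?J ** extend Q))"
    by (simp add: extend_def[of "Q\<^sup>T"] matrix_add_rdistrib matrix_diff_rdistrib matrix_mul_assoc)
  also have "\<dots> = ?J\<^sup>T ** (Q\<^sup>T ** Q) ** ?J + (extend Q - ?J\<^sup>T ** Q ** ?J)"
    by (simp add: rect_id_extend[OF n] matrix_mul_assoc)
  also have "\<dots> = mat 1"
    by (simp add: QQ extend_def)
  finally show ?thesis by (simp add: orthogonal_matrix transpose_extend)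
qed

definition psd :: "real^'n^'n \<Rightarrow> bool" where
  "psd S \<longleftrightarrow> S\<^sup>T = S \<and> (\<forall>x. 0 \<le> x \<bullet> (S *v x))"

lemma inner_mat_1: "mat 1 \<bullet> A = trace (A :: real^'n^'n)"
  by (simp add: diagonal_one[symmetric] inner_diagonal trace_def inner_commute[of "diagonal _"])

text \<open>
  A spectral decomposition \<open>S = R diag(d) R\<^sup>T\<close> is a singular value decomposition of \<open>S ** J\<close> once
  \<open>R\<^sup>T\<close> is moved past \<open>J\<close>.  The product \<open>U J V\<^sup>T\<close> does not change, so the contraction it defines
  remains norming for the new singular vectors.
\<close>

lemma svd_of_psd:
  fixes S :: "('n1::{finite,linorder}, 'n1) rmat" and V :: "('n2::{finite,linorder}, 'n2) rmat"
  assumes n: "CARD('n1) \<le> CARD('n2)" and S: "psd S"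
    and U: "orthogonal_matrix U" and V: "orthogonal_matrix V"
  obtains P Q d where "is_svd P Q d (U ** (S ** J) ** V\<^sup>T)" "P ** J ** Q\<^sup>T = U ** J ** V\<^sup>T"
    "(\<Sum>i\<in>UNIV. d i) = trace S"
proof -
  obtain R d where R: "orthogonal_matrix R" "S = R ** diagonal d ** R\<^sup>T" "antimono d"
    using symmetric_spectral_decomposition S unfolding psd_def by metis
  have RR: "R\<^sup>T ** R = mat 1" "R ** R\<^sup>T = mat 1" using R(1) by (auto simp: orthogonal_matrix_def)
  have d_nonneg: "0 \<le> d i" for i
  proof -
    define x where "x = R *v axis i 1"
    have x: "R\<^sup>T *v x = axis i 1" by (simp only: x_def matrix_vector_mul_assoc RR matrix_vector_mul_lid)
    have "x \<bullet> (S *v x) = (R\<^sup>T *v x) \<bullet> (diagonal d *v (R\<^sup>T *v x))"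
      unfolding R(2) matrix_vector_mul_assoc[symmetric] by (rule inner_matrix_vector)
    also have "\<dots> = d i"
      unfolding x inner_axis' diagonal_mult_vec by (simp add: axis_def)
    finally show ?thesis using S unfolding psd_def by metis
  qed
  define P Q where "P = U ** R" and "Q = V ** extend R"
  have JQ: "A ** J ** Q\<^sup>T = A ** R\<^sup>T ** J ** V\<^sup>T" for A :: "('n1, 'n1) rmat"
  proof -
    have "A ** J ** Q\<^sup>T = A ** (J ** extend (R\<^sup>T)) ** V\<^sup>T"
      by (simp add: Q_def matrix_transpose_mul transpose_extend matrix_mul_assoc)
    then show ?thesis by (simp add: rect_id_extend[OF n] matrix_mul_assoc)
  qed
  have "U ** (S ** J) ** V\<^sup>T = P ** (diagonal d ** J) ** Q\<^sup>T"
    using JQ[of "P ** diagonal d"] by (simp add: R(2) P_def matrix_mul_assoc)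
  then have 1: "is_svd P Q d (U ** (S ** J) ** V\<^sup>T)"
    using d_nonneg R(1,3) U V
    by (simp add: is_svd_def P_def Q_def orthogonal_matrix_mul orthogonal_extend[OF n])
  have 2: "P ** J ** Q\<^sup>T = U ** J ** V\<^sup>T"
    using JQ[of P] RR(2) by (simp add: P_def flip: matrix_mul_assoc) 
  have 3: "trace S = (\<Sum>i\<in>UNIV. d i)"
  proof -
    have "trace S = mat 1 \<bullet> (R ** diagonal d ** R\<^sup>T)" by (simp add: R(2) inner_mat_1)
    also have "mat 1 = R ** mat 1 ** R\<^sup>T" by (simp add: RR)
    also have "(R ** mat 1 ** R\<^sup>T) \<bullet> (R ** diagonal d ** R\<^sup>T) = mat 1 \<bullet> diagonal d"
      by (rule inner_orthogonal_conj[OF R(1) R(1)])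
    also have "\<dots> = (\<Sum>i\<in>UNIV. d i)" by (simp add: inner_mat_1 trace_def)
    finally show ?thesis .
  qed
  show ?thesis by (rule that[OF 1 2 3[symmetric]])
qed

lemma nuclear_norm_psd:
  fixes S :: "('n1::{finite,linorder}, 'n1) rmat" and V :: "('n2::{finite,linorder}, 'n2) rmat"
  assumes n: "CARD('n1) \<le> CARD('n2)" and S: "psd S"
    and U: "orthogonal_matrix U" and V: "orthogonal_matrix V"
  shows "nuclear_norm (U ** (S ** J) ** V\<^sup>T) = trace S"
proof -
  obtain P Q d where "is_svd P Q d (U ** (S ** J) ** V\<^sup>T)" "(\<Sum>i\<in>UNIV. d i) = trace S"
    by (rule svd_of_psd[OF n S U V])
  then show ?thesis using nuclear_norm_svd[OF n] by metis
qed

definition gram :: "('n \<Rightarrow> 'a::real_inner) \<Rightarrow> real^'n^'n" where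
  "gram w = (\<chi> i j. w i \<bullet> w j)"

lemma gram_quadratic_form:
  "x \<bullet> (gram w *v x) = (norm (\<Sum>i\<in>UNIV. x $ i *\<^sub>R w i))\<^sup>2"
  unfolding power2_norm_eq_inner inner_sum_left inner_sum_right
  by (simp add: gram_def inner_vec_def matrix_vector_mult_def sum_distrib_left mult.left_commute mult.commute inner_commute)

lemma psd_gram: "psd (gram w)"
  by (simp add: psd_def gram_quadratic_form) (simp add: gram_def transpose_def Finite_Cartesian_Product.vec_eq_iff inner_commute)

lemma norm_contraction_le_1: "contraction Z \<Longrightarrow> norm x = 1 \<Longrightarrow> norm (Z *v x) \<le> 1"
  unfolding contraction_def by metis

lemma inner_eq_1_imp_eq:
  assumes "norm u = 1" "norm v \<le> 1" "u \<bullet> v = 1"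
  shows "u = (v :: 'a::real_inner)"
proof -
  have "(norm (u - v))\<^sup>2 = (norm u)\<^sup>2 + (norm v)\<^sup>2 - 2 * (u \<bullet> v)"
    by (simp add: power2_norm_eq_inner inner_diff_left inner_diff_right inner_commute)
  also have "\<dots> \<le> 0" using assms by (simp add: power_le_one)
  finally show ?thesis by simp
qed

lemma matrix_sum_left: "sum f K ** B = (\<Sum>k\<in>K. f k ** (B :: real^'n^'k))"
proof -
  have "0 ** B = (0 :: real^'n^'m)"
    by (simp add: matrix_matrix_mult_def Finite_Cartesian_Product.vec_eq_iff)
  then show ?thesis
    by (induction K rule: infinite_finite_induct) (simp_all add: matrix_add_rdistrib)
qed

text \<open>
  Equality in \<open>contraction_inner_le_nuclear_norm\<close> for \<open>D = (diag(c) 0)\<close>.  Every singular triple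
  \<open>(\<sigma>, p, q)\<close> of \<open>M\<close> with \<open>\<sigma> \<noteq> 0\<close> must satisfy \<open>p \<bullet> D q = 1\<close>, hence \<open>p = D q\<close> and \<open>q = D\<^sup>T p\<close>.
  Then \<open>p = D D\<^sup>T p = diag(c\<^sup>2) p\<close>, so \<open>p\<close> lives on the indices with \<open>c i = 1\<close>, and there \<open>q\<close> is \<open>p\<close>
  padded with zeros.  Thus \<open>M = \<Sum> \<sigma> p p\<^sup>T J\<close>.  The positive semidefinite factor is recorded as a Gram
  matrix, because the later factorisation of its blocks is a projection argument on the vectors \<open>w i\<close>.
\<close>

lemma norming_diagonal_imp_gram:
  fixes M :: "('n1::{finite,linorder}, 'n2::{finite,linorder}) rmat"
  assumes n: "CARD('n1) \<le> CARD('n2)" and c: "\<And>i. 0 \<le> c i" "\<And>i. c i \<le> 1"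
    and norming: "(diagonal c ** J) \<bullet> M = nuclear_norm M"
  obtains w :: "'n1 \<Rightarrow> (real, 'n1) Finite_Cartesian_Product.vec" where "M = gram w ** J" "\<And>i. c i \<noteq> 1 \<Longrightarrow> w i = 0"
proof -
  obtain U V d where svd: "is_svd U V d M" by (rule svd_exists[OF n, of M])
  note nuc = nuclear_norm_svd[OF n svd] and svd = is_svdD[OF svd]
  define D where "D = diagonal c ** (J :: ('n1, 'n2) rmat)"
  have D: "contraction D"
    unfolding D_def by (intro contraction_mult contraction_diagonal contraction_rect_id n c)
  define p q where "p k = column k U" and "q k = column (of_pos (pos k)) V" for k :: 'n1
  have p: "norm (p k) = 1" and q: "norm (q k) = 1" for k
    using svd(1,2) by (auto simp: p_def q_def norm_column_orthogonal)
  have M: "M = (\<Sum>k\<in>UNIV. d k *\<^sub>R outer (p k) (q k))"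
    unfolding p_def q_def svd_outer[OF n, symmetric] by (rule svd(5))
  have "(\<Sum>k\<in>UNIV. d k * (1 - p k \<bullet> (D *v q k))) = 0"
    using norming unfolding nuc D_def[symmetric]
    by (subst (asm) M) (simp add: inner_sum_right inner_outer right_diff_distrib sum_subtractf)
  moreover have "0 \<le> d k * (1 - p k \<bullet> (D *v q k))" for k
    using inner_contraction_le_1[OF D p q] svd(4) by simp
  ultimately have *: "d k = 0 \<or> p k \<bullet> (D *v q k) = 1" for k
    by (subst (asm) sum_nonneg_eq_0_iff) auto
  have key: "outer (p k) (q k) = outer (p k) (p k) ** J" "\<And>i. c i \<noteq> 1 \<Longrightarrow> p k $ i = 0" if "d k \<noteq> 0" for k
  proof -
    have 1: "p k \<bullet> (D *v q k) = 1" using * that by blast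
    have pk: "p k = D *v q k"
      by (rule inner_eq_1_imp_eq[OF p norm_contraction_le_1[OF D q] 1])
    have "q k \<bullet> (D\<^sup>T *v p k) = 1"
      using 1 unfolding inner_matrix_vector[of "p k" D "q k"] by (simp only: inner_commute)
    from inner_eq_1_imp_eq[OF q norm_contraction_le_1[OF contraction_transpose[OF D] p] this]
    have qk: "q k = D\<^sup>T *v p k" .
    have DD: "D ** D\<^sup>T = diagonal (\<lambda>i. c i * c i)"
    proof -
      have "D ** D\<^sup>T = diagonal c ** (J ** (J :: ('n1, 'n2) rmat)\<^sup>T) ** diagonal c"
        by (simp add: D_def matrix_transpose_mul matrix_mul_assoc)
      then show ?thesis by (simp add: rect_id_mult_transpose[OF n] diagonal_mult_diagonal)
    qed
    have eq: "p k = diagonal (\<lambda>i. c i * c i) *v p k"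
      unfolding DD[symmetric] by (simp only: matrix_vector_mul_assoc[symmetric] qk[symmetric] pk[symmetric])
    have "p k $ i = c i * c i * p k $ i" for i
      using arg_cong[OF eq, of "\<lambda>v. v $ i"] unfolding diagonal_mult_vec .
    then have "(1 - c i) * ((1 + c i) * p k $ i) = 0" for i
      by (simp add: algebra_simps)
    moreover have "1 + c i \<noteq> 0" for i using c(1)[of i] by linarith
    ultimately have pk0: "c i = 1 \<or> p k $ i = 0" for i by fastforce
    then show "\<And>i. c i \<noteq> 1 \<Longrightarrow> p k $ i = 0" by blast
    have "q k = (J :: ('n1, 'n2) rmat)\<^sup>T *v (diagonal c *v p k)"
      by (subst qk) (simp add: D_def matrix_transpose_mul matrix_vector_mul_assoc)
    also have "diagonal c *v p k = p k"
      using pk0 by (auto simp: Finite_Cartesian_Product.vec_eq_iff diagonal_mult_vec)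
    finally have "q k = (J :: ('n1, 'n2) rmat)\<^sup>T *v p k" .
    then have "q k $ j = (\<Sum>l\<in>UNIV. p k $ l * (J :: ('n1, 'n2) rmat) $ l $ j)" for j
      unfolding matrix_vector_mult_def transpose_def by (simp add: mult.commute)
    then show "outer (p k) (q k) = outer (p k) (p k) ** J"
      unfolding Finite_Cartesian_Product.vec_eq_iff outer_def matrix_matrix_mult_def vec_lambda_beta
      by (simp only: sum_distrib_left mult.assoc simp_thms)
  qed
  \<comment> \<open>The vectors \<open>w i\<close> are the rows of the square root factor with columns \<open>sqrt (d k) *\<^sub>R p k\<close>.\<close>
  define w where "w i = (\<chi> k. sqrt (d k) * p k $ i)" for i
  have gram: "gram w = (\<Sum>k\<in>UNIV. d k *\<^sub>R outer (p k) (p k))"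
  proof -
    have "gram w $ i $ j = (\<Sum>k\<in>UNIV. (sqrt (d k) * sqrt (d k)) * (p k $ i * p k $ j))" for i j
      unfolding gram_def w_def inner_vec_def vec_lambda_beta inner_real_def
      by (rule sum.cong[OF refl]) (simp only: ac_simps)
    then show ?thesis using svd(4)
      by (simp add: Finite_Cartesian_Product.vec_eq_iff outer_def)
  qed
  have "M = (\<Sum>k\<in>UNIV. d k *\<^sub>R (outer (p k) (p k) ** J))"
  proof -
    have eq: "d k *\<^sub>R outer (p k) (q k) = d k *\<^sub>R (outer (p k) (p k) ** J)" for k
      by (cases "d k = 0") (simp_all add: key(1))
    show ?thesis by (subst M) (simp only: eq)
  qed
  also have "\<dots> = gram w ** J"
    by (simp add: gram matrix_sum_left matrix_scaleR_left)
  finally have "M = gram w ** J" .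
  moreover have "w i = 0" if "c i \<noteq> 1" for i
    using key(2)[OF _ that] by (auto simp: w_def Finite_Cartesian_Product.vec_eq_iff)
  ultimately show ?thesis using that by blast
qed

section \<open>Block matrices\<close>

text \<open>
  Blocks of variable size, placed at row \<open>a\<close> and column \<open>b\<close>, become matrices of one type, so that they can be
  multiplied and compared with full matrices.
\<close>

definition embed_at :: "nat \<Rightarrow> nat \<Rightarrow> real mat \<Rightarrow> ('n1::{finite,linorder}, 'n2::{finite,linorder}) rmat" where
  "embed_at a b M = (\<chi> i j. if (a \<le> pos i \<and> pos i < a + dim_row M) \<and> (b \<le> pos j \<and> pos j < b + dim_col M)
     then M $$ (pos i - a, pos j - b) else 0)"

definition in_block :: "nat \<Rightarrow> nat \<Rightarrow> nat \<Rightarrow> nat \<Rightarrow> ('n1::{finite,linorder}, 'n2::{finite,linorder}) rmat \<Rightarrow> bool" where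
  "in_block a m b k S \<longleftrightarrow>
     (\<forall>i j. S $ i $ j \<noteq> 0 \<longrightarrow> (a \<le> pos i \<and> pos i < a + m) \<and> (b \<le> pos j \<and> pos j < b + k))"

definition restrict_to :: "nat \<Rightarrow> nat \<Rightarrow> nat \<Rightarrow> nat \<Rightarrow> ('n1::{finite,linorder}, 'n2::{finite,linorder}) rmat \<Rightarrow> real mat" where
  "restrict_to a m b k S = Matrix.mat m k (\<lambda>(x, y). S $ of_pos (a + x) $ of_pos (b + y))"

lemma restrict_to_carrier [simp]: "restrict_to a m b k S \<in> carrier_mat m k"
  by (simp add: restrict_to_def)

lemma in_block_embed_at: "M \<in> carrier_mat m k \<Longrightarrow> in_block a m b k (embed_at a b M)"
  by (auto simp: in_block_def embed_at_def)

lemma embed_restrict: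
  assumes "in_block a m b k S"
  shows "embed_at a b (restrict_to a m b k S) = S"
proof -
  have "embed_at a b (restrict_to a m b k S) $ i $ j = S $ i $ j" for i j
    using assms by (auto simp: embed_at_def restrict_to_def in_block_def)
  then show ?thesis by (simp add: Finite_Cartesian_Product.vec_eq_iff)
qed

lemma sum_block:
  assumes "a + m \<le> CARD('n)"
  shows "(\<Sum>i\<in>(UNIV::'n::{finite,linorder} set). if a \<le> pos i \<and> pos i < a + m then f (pos i - a) else 0) =
    (\<Sum>k<m. f k)"
proof -
  have "(\<Sum>i\<in>(UNIV::'n set). if a \<le> pos i \<and> pos i < a + m then f (pos i - a) else 0) =
      (\<Sum>u<CARD('n). if a \<le> u \<and> u < a + m then f (u - a) else 0)"
    by (rule sum_pos)
  also have "\<dots> = (\<Sum>u\<in>{a..<a + m}. f (u - a))"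
    using assms by (intro sum.mono_neutral_cong_right) auto
  also have "\<dots> = (\<Sum>k<m. f k)"
    by (rule sum.reindex_bij_witness[of _ "\<lambda>k. k + a" "\<lambda>u. u - a"]) auto
  finally show ?thesis .
qed

lemma embed_at_transpose: "embed_at b a (transpose_mat M) = (embed_at a b M)\<^sup>T"
  by (auto simp: embed_at_def transpose_def Finite_Cartesian_Product.vec_eq_iff)

lemma embed_at_mult:
  fixes M N :: "real mat"
  assumes M: "M \<in> carrier_mat m k" and N: "N \<in> carrier_mat k l" and k: "b + k \<le> CARD('n)"
  shows "(embed_at a c (M * N) :: ('n1::{finite,linorder}, 'n2::{finite,linorder}) rmat) =
    embed_at a b M ** (embed_at b c N :: ('n::{finite,linorder}, 'n2) rmat)"
proof -
  have "(embed_at a c (M * N) :: ('n1, 'n2) rmat) $ i $ j =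
    (embed_at a b M ** (embed_at b c N :: ('n, 'n2) rmat)) $ i $ j" for i j
  proof (cases "(a \<le> pos i \<and> pos i < a + m) \<and> (c \<le> pos j \<and> pos j < c + l)")
    case True
    then have ij: "pos i - a < m" "pos j - c < l" by auto
    have "(embed_at a b M ** (embed_at b c N :: ('n, 'n2) rmat)) $ i $ j = (\<Sum>x\<in>UNIV.
        if b \<le> pos (x :: 'n) \<and> pos x < b + k then M $$ (pos i - a, pos x - b) * N $$ (pos x - b, pos j - c) else 0)"
      unfolding matrix_matrix_mult_def vec_lambda_beta
      using True M N by (intro sum.cong refl) (simp add: embed_at_def)
    also have "\<dots> = (\<Sum>t<k. M $$ (pos i - a, t) * N $$ (t, pos j - c))"
      by (rule sum_block[OF k])
    also have "\<dots> = (embed_at a c (M * N) :: ('n1, 'n2) rmat) $ i $ j"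
      using True ij M N by (simp add: embed_at_def scalar_prod_def lessThan_atLeast0)
    finally show ?thesis by simp
  next
    case False
    then show ?thesis
      unfolding matrix_matrix_mult_def vec_lambda_beta
      using M N by (subst sum.neutral) (auto simp: embed_at_def)
  qed
  then show ?thesis unfolding Finite_Cartesian_Product.vec_eq_iff by blast
qed

lemma trace_embed_at:
  assumes "M \<in> carrier_mat m m" and "a + m \<le> CARD('n)"
  shows "trace (embed_at a a M :: ('n::{finite,linorder}, 'n) rmat) = tr M"
proof -
  have "trace (embed_at a a M :: ('n, 'n) rmat) =
      (\<Sum>i\<in>(UNIV::'n set). if a \<le> pos i \<and> pos i < a + m then M $$ (pos i - a, pos i - a) else 0)"
    unfolding trace_def using assms(1) by (intro sum.cong refl) (simp add: embed_at_def)
  also have "\<dots> = tr M"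
    using sum_block[OF assms(2), of "\<lambda>k. M $$ (k, k)"] assms(1) by (simp add: tr_def)
  finally show ?thesis .
qed

lemma quadratic_form_embed_at:
  fixes x :: "real^'n::{finite,linorder}"
  assumes M: "M \<in> carrier_mat m m" and m: "a + m \<le> CARD('n)"
    and y: "y \<in> carrier_vec m" "\<And>k. k < m \<Longrightarrow> vec_index y k = x $ of_pos (a + k)"
  shows "x \<bullet> (embed_at a a M *v x) = scalar_prod y (M *\<^sub>v y)"
proof -
  have x: "x $ i = vec_index y (pos i - a)" if "a \<le> pos i \<and> pos i < a + m" for i
    using y(2)[of "pos i - a"] that by (simp add: less_diff_conv2)
  have inner: "(embed_at a a M *v x) $ i =
      (if a \<le> pos i \<and> pos i < a + m then vec_index (M *\<^sub>v y) (pos i - a) else 0)" for i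
  proof (cases "a \<le> pos i \<and> pos i < a + m")
    case True
    have "(embed_at a a M *v x) $ i = (\<Sum>j\<in>UNIV. if a \<le> pos (j :: 'n) \<and> pos j < a + m
        then M $$ (pos i - a, pos j - a) * vec_index y (pos j - a) else 0)"
      unfolding matrix_vector_mult_def vec_lambda_beta
      using True M by (intro sum.cong refl) (auto simp: embed_at_def x)
    also have "\<dots> = (\<Sum>l<m. M $$ (pos i - a, l) * vec_index y l)"
      by (rule sum_block[OF m])
    finally show ?thesis
      using True M y(1) by (simp add: scalar_prod_def lessThan_atLeast0 less_diff_conv2)
  next
    case False
    then show ?thesis
      unfolding matrix_vector_mult_def vec_lambda_beta
      using M by (subst sum.neutral) (auto simp: embed_at_def)
  qed
  have "x \<bullet> (embed_at a a M *v x) = (\<Sum>i\<in>UNIV. if a \<le> pos (i :: 'n) \<and> pos i < a + m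
      then vec_index y (pos i - a) * vec_index (M *\<^sub>v y) (pos i - a) else 0)"
    unfolding inner_vec_def inner by (intro sum.cong refl) (simp add: x)
  also have "\<dots> = (\<Sum>k<m. vec_index y k * vec_index (M *\<^sub>v y) k)"
    by (rule sum_block[OF m])
  finally show ?thesis
    using M by (simp add: scalar_prod_def[of y] lessThan_atLeast0)
qed

lemma mult_rect_id_nth:
  fixes S :: "('n1::{finite,linorder}, 'n1) rmat" and j :: "'n2::{finite,linorder}"
  shows "(S ** J) $ i $ j = (if pos j < CARD('n1) then S $ i $ of_pos (pos j) else 0)"
proof -
  have "(S ** J) $ i $ j = (\<Sum>k\<in>UNIV. if pos k = pos j then S $ i $ k else 0)"
    unfolding matrix_matrix_mult_def vec_lambda_beta by (rule sum.cong[OF refl]) simp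
  also have "\<dots> = (if pos j < CARD('n1) then S $ i $ of_pos (pos j) else 0)"
  proof (cases "pos j < CARD('n1)")
    case True
    then have "pos k = pos j \<longleftrightarrow> k = of_pos (pos j)" for k :: 'n1
      using of_pos_pos[of k] by (metis pos_of_pos)
    then show ?thesis using True by simp
  next
    case False
    then have "pos (k :: 'n1) \<noteq> pos j" for k using pos_less_card[of k] by metis
    then show ?thesis using False by simp
  qed
  finally show ?thesis .
qed

lemma zero_pad_four_block:
  assumes A: "A \<in> carrier_mat r r" and P: "P \<in> carrier_mat r s" and Q: "Q \<in> carrier_mat s r"
    and C: "C \<in> carrier_mat s s" and rs: "r + s \<le> CARD('n1)"
  shows "zero_pad (four_block_mat A P Q C) =
    (embed_at 0 0 A + embed_at 0 r P + embed_at r 0 Q + embed_at r r C :: ('n1, 'n1) rmat) **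
      (J :: ('n1::{finite,linorder}, 'n2::{finite,linorder}) rmat)"
proof -
  have "zero_pad (four_block_mat A P Q C) $ i $ j =
    ((embed_at 0 0 A + embed_at 0 r P + embed_at r 0 Q + embed_at r r C :: ('n1, 'n1) rmat) ** J) $ i $ j"
    for i :: 'n1 and j :: 'n2
  proof (cases "pos j < r + s")
    case True
    then have "pos j < CARD('n1)" using rs by simp
    then show ?thesis
      using A P Q C by (auto simp: mult_rect_id_nth zero_pad_def embed_at_def)
  next
    case False
    then show ?thesis
      using A P Q C by (auto simp: mult_rect_id_nth zero_pad_def embed_at_def)
  qed
  then show ?thesis by (simp add: Finite_Cartesian_Product.vec_eq_iff)
qed

lemma psd_embed_at:
  assumes "C \<in> psd_mats m" "a + m \<le> CARD('n)"
  shows "psd (embed_at a a C :: ('n::{finite,linorder}, 'n) rmat)"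
proof -
  have C: "C \<in> carrier_mat m m" "transpose_mat C = C" "\<And>x. x \<in> carrier_vec m \<Longrightarrow> 0 \<le> scalar_prod x (C *\<^sub>v x)"
    using assms(1) by (auto simp: psd_mats_def sym_mats_def)
  have "0 \<le> x \<bullet> (embed_at a a C *v x)" for x :: "(real, 'n) Finite_Cartesian_Product.vec"
    using quadratic_form_embed_at[OF C(1) assms(2), of "Matrix.vec m (\<lambda>k. x $ of_pos (a + k))" x] C(3) by simp
  moreover have "(embed_at a a C)\<^sup>T = (embed_at a a C :: ('n, 'n) rmat)"
    by (metis C(2) embed_at_transpose)
  ultimately show ?thesis by (simp add: psd_def)
qed

lemma psd_restrict:
  fixes S :: "('n::{finite,linorder}, 'n) rmat"
  assumes S: "psd S" "in_block a m a m S" and m: "a + m \<le> CARD('n)"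
  shows "restrict_to a m a m S \<in> psd_mats m"
proof -
  let ?C = "restrict_to a m a m S"
  have "transpose_mat ?C = ?C"
  proof (rule eq_matI)
    fix i j assume ij: "i < dim_row ?C" "j < dim_col ?C"
    have "S $ k $ l = S $ l $ k" for k l
      using S(1) unfolding psd_def by (metis transpose_def vec_lambda_beta)
    then show "transpose_mat ?C $$ (i, j) = ?C $$ (i, j)" using ij by (simp add: restrict_to_def)
  qed (simp_all add: restrict_to_def)
  moreover have "0 \<le> scalar_prod y (?C *\<^sub>v y)" if y: "y \<in> carrier_vec m" for y
  proof -
    define x :: "(real, 'n) Finite_Cartesian_Product.vec" where "x = (\<chi> i. vec_index y (pos i - a))"
    have "vec_index y k = x $ of_pos (a + k)" if "k < m" for k
      using that m by (simp add: x_def)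
    from quadratic_form_embed_at[OF restrict_to_carrier[of a m a m S] m y this]
    have "x \<bullet> (S *v x) = scalar_prod y (?C *\<^sub>v y)" by (simp only: embed_restrict[OF S(2)])
    then show ?thesis using S(1) unfolding psd_def by metis
  qed
  ultimately show ?thesis by (simp add: psd_mats_def sym_mats_def)
qed

text \<open>
  Blocks whose size depends on the rank are traded for full-size matrices supported in these blocks,
  so that the arguments below can use inner products, orthogonal factors and \<open>J\<close> without block
  arithmetic.
\<close>

lemma block_mats_iff:
  fixes M :: "('n1::{finite,linorder}, 'n2::{finite,linorder}) rmat"
  assumes rq: "r \<le> q" and q: "q \<le> CARD('n1)"
  shows "M \<in> block_mats r q \<longleftrightarrow> (\<exists>A B C. A\<^sup>T = A \<and> psd C \<and>
    in_block 0 r 0 r A \<and> in_block 0 r r (q - r) B \<and> in_block r (q - r) r (q - r) C \<and>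
    trace A + trace C = 0 \<and> M = (A + B ** C + (B ** C)\<^sup>T + C) ** J)" (is "_ \<longleftrightarrow> ?R")
proof
  assume "M \<in> block_mats r q"
  then obtain A B C where A: "A \<in> sym_mats r" and B: "B \<in> carrier_mat r (q - r)" and C: "C \<in> psd_mats (q - r)"
    and tr: "tr A + tr C = 0"
    and M: "M = zero_pad (four_block_mat A (B * C) (transpose_mat C * transpose_mat B) C)"
    unfolding block_mats_def by blast
  have A': "A \<in> carrier_mat r r" "transpose_mat A = A" and C': "C \<in> carrier_mat (q - r) (q - r)"
    using A C by (auto simp: sym_mats_def psd_mats_def)
  let ?A = "embed_at 0 0 A :: ('n1, 'n1) rmat" and ?B = "embed_at 0 r B :: ('n1, 'n1) rmat"
    and ?C = "embed_at r r C :: ('n1, 'n1) rmat"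
  have BC: "embed_at 0 r (B * C) = ?B ** ?C"
    using rq q by (intro embed_at_mult[OF B C']) auto
  have "transpose_mat C * transpose_mat B = transpose_mat (B * C)"
    by (rule transpose_mult[OF B C', symmetric])
  then have CB: "embed_at r 0 (transpose_mat C * transpose_mat B) = (?B ** ?C)\<^sup>T"
    by (simp add: embed_at_transpose BC)
  have "M = (?A + ?B ** ?C + (?B ** ?C)\<^sup>T + ?C) ** J"
    unfolding M using rq q B C'
    by (subst zero_pad_four_block[OF A'(1) _ _ C']) (auto simp: BC CB)
  moreover have "trace ?A + trace ?C = 0"
    using tr rq q by (simp add: trace_embed_at[OF A'(1)] trace_embed_at[OF C'])
  moreover have "?A\<^sup>T = ?A" by (metis A'(2) embed_at_transpose)
  ultimately show ?R
    using psd_embed_at[OF C, of r] in_block_embed_at A'(1) B C' rq q by (metis le_add_diff_inverse)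
next
  assume ?R
  then obtain A B C where A: "A\<^sup>T = A" and C: "psd C" and iA: "in_block 0 r 0 r A"
    and iB: "in_block 0 r r (q - r) B" and iC: "in_block r (q - r) r (q - r) C"
    and tr: "trace A + trace C = 0" and M: "M = (A + B ** C + (B ** C)\<^sup>T + C) ** J" by blast
  have le_CARD: "r + (q - r) \<le> CARD('n1)" using rq q by simp
  let ?A = "restrict_to 0 r 0 r A" and ?B = "restrict_to 0 r r (q - r) B"
    and ?C = "restrict_to r (q - r) r (q - r) C"
  have BC: "embed_at 0 r (?B * ?C) = B ** C"
    unfolding embed_at_mult[OF restrict_to_carrier[of 0 r r "q - r" B] restrict_to_carrier[of r "q - r" r "q - r" C]
        le_CARD] embed_restrict[OF iB] embed_restrict[OF iC] ..
  have "transpose_mat ?C * transpose_mat ?B = transpose_mat (?B * ?C)"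
    by (rule transpose_mult[OF restrict_to_carrier restrict_to_carrier, symmetric])
  then have CB: "embed_at r 0 (transpose_mat ?C * transpose_mat ?B) = (B ** C)\<^sup>T"
    by (simp add: embed_at_transpose BC)
  have "zero_pad (four_block_mat ?A (?B * ?C) (transpose_mat ?C * transpose_mat ?B) ?C) = M"
    unfolding M using zero_pad_four_block[OF restrict_to_carrier[of 0 r 0 r A]
        mult_carrier_mat[OF restrict_to_carrier[of 0 r r "q - r" B] restrict_to_carrier[of r "q - r" r "q - r" C]]
        mult_carrier_mat[OF transpose_carrier_mat[THEN iffD2, OF restrict_to_carrier[of r "q - r" r "q - r" C]]
          transpose_carrier_mat[THEN iffD2, OF restrict_to_carrier[of 0 r r "q - r" B]]]
        restrict_to_carrier[of r "q - r" r "q - r" C] le_CARD]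
    by (simp only: BC CB embed_restrict[OF iA] embed_restrict[OF iC])
  moreover have "?A \<in> sym_mats r"
  proof -
    have "A $ x $ y = A $ y $ x" for x y
      using A by (metis transpose_def vec_lambda_beta)
    then have "transpose_mat ?A = ?A" by (intro eq_matI) (simp_all add: restrict_to_def)
    then show ?thesis by (simp add: sym_mats_def)
  qed
  moreover have "?C \<in> psd_mats (q - r)"
    using rq q by (intro psd_restrict C iC) auto
  moreover have "tr ?A + tr ?C = 0"
  proof -
    have "tr ?A = trace A"
      using rq q trace_embed_at[OF restrict_to_carrier[of 0 r 0 r A], of 0, where 'n='n1]
      by (simp add: embed_restrict[OF iA])
    moreover have "tr ?C = trace C"
      using trace_embed_at[OF restrict_to_carrier[of r "q - r" r "q - r" C] le_CARD]
      by (simp add: embed_restrict[OF iC])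
    ultimately show ?thesis using tr by simp
  qed
  ultimately show "M \<in> block_mats r q"
    unfolding block_mats_def using restrict_to_carrier by blast
qed

section \<open>Simultaneous decompositions and rank\<close>

lemma ortho_pairs_iff_svd:
  fixes X :: "('n1::{finite,linorder}, 'n2::{finite,linorder}) rmat"
  assumes n: "CARD('n1) \<le> CARD('n2)"
  shows "(U, V) \<in> ortho_pairs X \<longleftrightarrow> (\<exists>d. is_svd U V d X)"
proof
  assume UV: "(U, V) \<in> ortho_pairs X"
  obtain P Q d where svd: "is_svd P Q d X" by (rule svd_exists[OF n, of X])
  have "is_svd U V d X"
    using UV is_svdD(3,4)[OF svd] unfolding is_svd_def ortho_pairs_def Diag_sigma_svd[OF n svd] by blast
  then show "\<exists>d. is_svd U V d X" by blast
next
  assume "\<exists>d. is_svd U V d X"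
  then obtain d where svd: "is_svd U V d X" by blast
  show "(U, V) \<in> ortho_pairs X"
    using is_svdD[OF svd] unfolding ortho_pairs_def Diag_sigma_svd[OF n svd] by blast
qed

lemma rank_diagonal: "rank (diagonal (d :: 'n::finite \<Rightarrow> real)) = card {i. d i \<noteq> 0}"
proof -
  have "range (\<lambda>x. diagonal d *v x) = {x :: real^'n. \<forall>i. i \<notin> {i. d i \<noteq> 0} \<longrightarrow> x $ i = 0}"
  proof (intro subset_antisym subsetI)
    fix y :: "real^'n" assume "y \<in> {x. \<forall>i. i \<notin> {i. d i \<noteq> 0} \<longrightarrow> x $ i = 0}"
    then have "y = diagonal d *v (\<chi> i. y $ i / d i)"
      by (auto simp: Finite_Cartesian_Product.vec_eq_iff diagonal_mult_vec)
    then show "y \<in> range (\<lambda>x. diagonal d *v x)" by blast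
  qed (auto simp: diagonal_mult_vec)
  then show ?thesis unfolding rank_dim_range by (simp only: dim_vec_eq[symmetric] dim_substandard_cart)
qed

text \<open>
  Each of \<open>X\<close> and \<open>diagonal d\<close> is a product in which the other one is a factor, so neither rank
  exceeds the other.
\<close>

lemma rank_svd:
  fixes X :: "('n1::{finite,linorder}, 'n2::{finite,linorder}) rmat"
  assumes n: "CARD('n1) \<le> CARD('n2)" and svd: "is_svd U V d X"
  shows "rank X = card {i. d i \<noteq> 0}"
proof (rule antisym)
  note U = is_svdD(1)[OF svd] and V = is_svdD(2)[OF svd] and X = is_svdD(5)[OF svd]
  have "rank X \<le> rank (U ** diagonal d)"
    unfolding X matrix_mul_assoc by (meson order_trans rank_mul_le_left)
  also have "\<dots> \<le> rank (diagonal d)" by (rule rank_mul_le_right)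
  finally show "rank X \<le> card {i. d i \<noteq> 0}" by (simp only: rank_diagonal)
  let ?J = "J :: ('n1, 'n2) rmat"
  have "U\<^sup>T ** X ** (V ** ?J\<^sup>T) = (U\<^sup>T ** U) ** diagonal d ** (?J ** (V\<^sup>T ** V) ** ?J\<^sup>T)"
    unfolding X by (simp only: matrix_mul_assoc)
  also have "\<dots> = diagonal d"
    using U V by (simp add: orthogonal_matrix rect_id_mult_transpose[OF n])
  finally have "rank (diagonal d) = rank (U\<^sup>T ** X ** (V ** ?J\<^sup>T))" by simp
  also have "\<dots> \<le> rank (U\<^sup>T ** X)" by (rule rank_mul_le_left)
  also have "\<dots> \<le> rank X" by (rule rank_mul_le_right)
  finally show "card {i. d i \<noteq> 0} \<le> rank X" by (simp only: rank_diagonal)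
qed

lemma svd_nonzero_iff:
  fixes X :: "('n1::{finite,linorder}, 'n2::{finite,linorder}) rmat"
  assumes n: "CARD('n1) \<le> CARD('n2)" and svd: "is_svd U V d X"
  shows "d i \<noteq> 0 \<longleftrightarrow> pos i < rank X"
proof -
  have "j \<in> {i. d i \<noteq> 0}" if "i \<in> {i. d i \<noteq> 0}" "j \<le> i" for i j
    using that antimonoD[OF is_svdD(3)[OF svd] that(2)] is_svdD(4)[OF svd, of i] by auto
  then have "i \<in> {i. d i \<noteq> 0} \<longleftrightarrow> pos i < card {i. d i \<noteq> 0}"
    by (rule card_down_closed_pos)
  then show ?thesis by (simp add: rank_svd[OF n svd])
qed

section \<open>Schur complements of Gram matrices\<close>

lemma span_image_finite:
  assumes "finite K" "y \<in> span (w ` K)"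
  obtains b where "y = (\<Sum>j\<in>K. b j *\<^sub>R w j)"
proof -
  let ?S = "{y. \<exists>b. y = (\<Sum>j\<in>K. b j *\<^sub>R w j)}"
  have "subspace ?S"
    unfolding subspace_def
  proof (intro conjI ballI allI)
    show "0 \<in> ?S" by (auto intro!: exI[of _ "\<lambda>_. 0"])
    fix x assume "x \<in> ?S"
    then obtain b where b: "x = (\<Sum>j\<in>K. b j *\<^sub>R w j)" by blast
    show "c *\<^sub>R x \<in> ?S" for c
      by (auto intro!: exI[of _ "\<lambda>j. c * b j"] simp: b scaleR_sum_right)
    show "x + y \<in> ?S" if "y \<in> ?S" for y
    proof -
      obtain b' where "y = (\<Sum>j\<in>K. b' j *\<^sub>R w j)" using \<open>y \<in> ?S\<close> by blast
      then show ?thesis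
        by (auto intro!: exI[of _ "\<lambda>j. b j + b' j"] simp: b scaleR_add_left sum.distrib)
    qed
  qed
  moreover have "w ` K \<subseteq> ?S"
  proof clarify
    fix k assume "k \<in> K"
    then have "w k = (\<Sum>j\<in>K. (if j = k then 1 else 0) *\<^sub>R w j)"
      using assms(1) by (simp add: if_distrib[of "\<lambda>x. x *\<^sub>R _"] cong: if_cong)
    then show "\<exists>b. w k = (\<Sum>j\<in>K. b j *\<^sub>R w j)"
      by (intro exI[of _ "\<lambda>j. if j = k then 1 else 0"])
  qed
  ultimately have "span (w ` K) \<subseteq> ?S" by (rule span_minimal[rotated])
  with assms(2) that show ?thesis by blast
qed

text \<open>
  The coefficients of the orthogonal projection of \<open>x\<close> onto the span of the \<open>w j\<close>.
\<close>

lemma orthogonal_projection_coefficients: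
  fixes x :: "'a::euclidean_space"
  assumes "finite K"
  obtains b where "\<And>l. l \<in> K \<Longrightarrow> x \<bullet> w l = (\<Sum>j\<in>K. b j * (w j \<bullet> w l))"
proof -
  obtain y z where y: "y \<in> span (w ` K)" and z: "\<And>v. v \<in> span (w ` K) \<Longrightarrow> real_inner_class.orthogonal z v" and x: "x = y + z"
    using orthogonal_subspace_decomp_exists[of "w ` K" x] by metis
  obtain b where b: "y = (\<Sum>j\<in>K. b j *\<^sub>R w j)"
    using span_image_finite[OF assms y] by metis
  have "x \<bullet> w l = (\<Sum>j\<in>K. b j * (w j \<bullet> w l))" if "l \<in> K" for l
    using z[of "w l"] that
    by (simp add: x b inner_add_left inner_sum_left real_inner_class.orthogonal_def span_base)
  then show ?thesis by (rule that)
qed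

text \<open>
  The off-diagonal block of a positive semidefinite matrix factors through its lower diagonal block.
  For a Gram matrix the reason is geometric: if \<open>\<Sum> b i j *\<^sub>R w j\<close> is the projection of \<open>w i\<close> onto
  the span of the vectors with index in the lower block \<open>K\<close>, then
  \<open>w i \<bullet> w l = \<Sum> b i j (w j \<bullet> w l)\<close> for \<open>l\<close> in \<open>K\<close>, which is the factorisation \<open>B C\<close>.  The diagonal
  matrix \<open>d\<close> only changes the upper diagonal block \<open>A\<close>, which may be indefinite.
\<close>

lemma gram_minus_diagonal_block_mats:
  fixes w :: "'n1::{finite,linorder} \<Rightarrow> 'a::euclidean_space"
  assumes rq: "r \<le> q" and q: "q \<le> CARD('n1)" and t: "0 < t"
    and w: "\<And>i. q \<le> pos i \<Longrightarrow> w i = 0" and d: "\<And>i. r \<le> pos i \<Longrightarrow> d i = 0"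
    and S: "S = (1 / t) *\<^sub>R (gram w - diagonal d)" and tr: "trace S = 0"
  shows "S ** J \<in> (block_mats r q :: ('n1, 'n2::{finite,linorder}) rmat set)"
proof -
  define K where "K = {j :: 'n1. r \<le> pos j \<and> pos j < q}"
  have "\<exists>b. \<forall>l\<in>K. w i \<bullet> w l = (\<Sum>j\<in>K. b j * (w j \<bullet> w l))" for i
    using orthogonal_projection_coefficients[of K "w i" w] by (metis finite)
  then obtain b where b: "\<And>i l. l \<in> K \<Longrightarrow> w i \<bullet> w l = (\<Sum>j\<in>K. b i j * (w j \<bullet> w l))" by metis
  have S_nth: "S $ i $ j = (w i \<bullet> w j - (if i = j then d i else 0)) / t" for i j
    by (simp add: S gram_def)
  define A :: "('n1, 'n1) rmat" where "A = (\<chi> i j. if pos i < r \<and> pos j < r then S $ i $ j else 0)"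
  define B :: "('n1, 'n1) rmat" where "B = (\<chi> i j. if pos i < r \<and> j \<in> K then b i j else 0)"
  define C :: "('n1, 'n1) rmat" where "C = gram (\<lambda>i. if i \<in> K then (1 / sqrt t) *\<^sub>R w i else 0)"
  have C_nth: "C $ i $ j = (if i \<in> K \<and> j \<in> K then (w i \<bullet> w j) / t else 0)" for i j
    using t by (simp add: C_def gram_def)
  have BC: "(B ** C) $ i $ l = (if pos i < r \<and> l \<in> K then S $ i $ l else 0)" for i l
  proof (cases "pos i < r \<and> l \<in> K")
    case True
    then have "i \<noteq> l" by (auto simp: K_def)
    have "(B ** C) $ i $ l = (\<Sum>j\<in>UNIV. if j \<in> K then b i j * (w j \<bullet> w l) / t else 0)"
      unfolding matrix_matrix_mult_def vec_lambda_beta C_nth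
      using True by (intro sum.cong refl) (simp add: B_def)
    also have "\<dots> = (\<Sum>j\<in>K. b i j * (w j \<bullet> w l)) / t"
      by (simp add: sum.If_cases sum_divide_distrib)
    also have "\<dots> = S $ i $ l" using True b[of l i] \<open>i \<noteq> l\<close> by (simp add: S_nth)
    finally show ?thesis using True by simp
  next
    case False
    then show ?thesis
      unfolding matrix_matrix_mult_def vec_lambda_beta C_nth by (subst sum.neutral) (auto simp: B_def)
  qed
  have sum_eq: "S = A + B ** C + (B ** C)\<^sup>T + C"
  proof -
    have sym: "S $ i $ j = S $ j $ i" for i j by (simp add: S_nth inner_commute)
    have "S $ i $ j = (A + B ** C + (B ** C)\<^sup>T + C) $ i $ j" for i j
    proof -
      have T: "(B ** C)\<^sup>T $ i $ j = (if pos j < r \<and> i \<in> K then S $ j $ i else 0)"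
        by (simp add: transpose_def BC)
      have out: "S $ k $ l = 0" if "q \<le> pos k \<or> q \<le> pos l" for k l
        using that w d rq by (auto simp: S_nth)
      have inK: "S $ i $ j = (w i \<bullet> w j) / t" if "i \<in> K" "j \<in> K"
        using that d by (simp add: S_nth K_def)
      consider "pos i < r" "pos j < r" | "pos i < r" "j \<in> K" | "i \<in> K" "pos j < r" | "i \<in> K" "j \<in> K"
        | "q \<le> pos i \<or> q \<le> pos j"
        unfolding K_def by fastforce
      then show ?thesis
      proof cases
        case 5
        then show ?thesis using out[of i j] rq by (auto simp: A_def BC T C_nth K_def)
      qed (use inK sym[of i j] rq in \<open>auto simp: A_def BC T C_nth K_def\<close>)
    qed
    then show ?thesis unfolding Finite_Cartesian_Product.vec_eq_iff by blast
  qed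
  have "A\<^sup>T = A"
    by (auto simp: A_def transpose_def Finite_Cartesian_Product.vec_eq_iff S_nth inner_commute)
  moreover have "psd C" unfolding C_def by (rule psd_gram)
  moreover have "in_block 0 r 0 r A" "in_block 0 r r (q - r) B" "in_block r (q - r) r (q - r) C"
    using rq by (auto simp: in_block_def A_def B_def C_nth K_def split: if_splits)
  moreover have "trace A + trace C = 0"
  proof -
    have "(B ** C) $ i $ i = 0" for i by (auto simp: BC K_def)
    then have "S $ i $ i = A $ i $ i + C $ i $ i" for i
      by (subst sum_eq) (simp add: transpose_def)
    then have "trace S = trace A + trace C" by (simp add: trace_def sum.distrib)
    then show ?thesis using tr by simp
  qed
  ultimately show ?thesis
    unfolding block_mats_iff[OF rq q] using sum_eq by blast
qed

lemma quadratic_form_nth: "x \<bullet> (H *v x) = (\<Sum>i\<in>UNIV. \<Sum>j\<in>UNIV. x $ i * H $ i $ j * x $ j)"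
  by (simp add: inner_vec_def matrix_vector_mult_def sum_distrib_left mult.assoc)

lemma diagonal_dominates_block:
  fixes H :: "('n::{finite,linorder}, 'n) rmat"
  assumes d: "\<And>i. 0 \<le> d i" "\<And>i. pos i < r \<Longrightarrow> 0 < d i" and H: "in_block 0 r 0 r H"
  obtains t where "0 < t" "\<And>x. 0 \<le> x \<bullet> (diagonal d *v x) + t * (x \<bullet> (H *v x))"
proof -
  obtain m where m: "0 < m" "\<And>i. pos i < r \<Longrightarrow> m \<le> d i"
  proof (rule that)
    \<comment> \<open>The 1 covers the case that no index has a position below \<open>r\<close>.\<close>
    let ?m = "Min (insert 1 (d ` {i. pos i < r}))"
    show "0 < ?m" using d(2) by (subst Min_gr_iff) auto
    show "?m \<le> d i" if "pos i < r" for i using that by (intro Min_le) auto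
  qed
  obtain k where k: "0 < k" "\<And>x. norm (H *v x) \<le> k * norm x"
    using bounded_linear.pos_bounded[OF matrix_vector_mul_bounded_linear[of H]] by (metis mult.commute)
  define t where "t = m / k"
  have "0 \<le> x \<bullet> (diagonal d *v x) + t * (x \<bullet> (H *v x))" for x
  proof -
    define z :: "(real, 'n) Finite_Cartesian_Product.vec" where "z = (\<chi> i. if pos i < r then x $ i else 0)"
    have eq: "x $ i * H $ i $ j * x $ j = z $ i * H $ i $ j * z $ j" for i j
      using H by (cases "H $ i $ j = 0") (auto simp: in_block_def z_def)
    have "x \<bullet> (H *v x) = z \<bullet> (H *v z)" unfolding quadratic_form_nth eq ..
    moreover have "\<bar>z \<bullet> (H *v z)\<bar> \<le> norm z * (k * norm z)"
      using Cauchy_Schwarz_ineq2[of z "H *v z"] k(2)[of z] by (meson mult_left_mono norm_ge_zero order_trans)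
    ultimately have "- (k * (z \<bullet> z)) \<le> x \<bullet> (H *v x)"
      by (simp add: power2_norm_eq_inner[symmetric] power2_eq_square algebra_simps)
    then have "t * (- (k * (z \<bullet> z))) \<le> t * (x \<bullet> (H *v x))"
      using m k by (intro mult_left_mono) (auto simp: t_def)
    then have "- (m * (z \<bullet> z)) \<le> t * (x \<bullet> (H *v x))"
      using k by (simp add: t_def)
    moreover have "m * (z \<bullet> z) \<le> x \<bullet> (diagonal d *v x)"
    proof -
      have "m * (z $ i * z $ i) \<le> x $ i * (d i * x $ i)" for i
      proof (cases "pos i < r")
        case True
        then show ?thesis using mult_right_mono[OF m(2)[OF True], of "x $ i * x $ i"]
          by (simp add: z_def mult.left_commute mult.commute)
      next
        case False
        then show ?thesis using mult_nonneg_nonneg[OF d(1)[of i], of "x $ i * x $ i"]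
          by (simp add: z_def mult.left_commute mult.commute)
      qed
      then show ?thesis by (simp add: inner_vec_def diagonal_mult_vec sum_distrib_left sum_mono)
    qed
    ultimately show ?thesis by linarith
  qed
  moreover have "0 < t" using m k by (simp add: t_def)
  ultimately show ?thesis using that by blast
qed

text \<open>
  The converse direction of the Schur complement criterion.  Completing the square with
  \<open>y = x + B\<^sup>T x\<close> turns the quadratic form of \<open>diag(d) + t (A + B C + (B C)\<^sup>T + C)\<close> into that of
  \<open>diag(d) + t (A - B C B\<^sup>T)\<close> at \<open>x\<close> plus \<open>t y \<bullet> C y\<close>.  The matrix \<open>A - B C B\<^sup>T\<close> is supported in the block
  where \<open>d\<close> is positive, so \<open>d\<close> dominates it for small \<open>t\<close>.
\<close>

lemma block_mats_perturbation_psd: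
  fixes M :: "('n1::{finite,linorder}, 'n2::{finite,linorder}) rmat"
  assumes rq: "r \<le> q" and q: "q \<le> CARD('n1)" and M: "M \<in> block_mats r q"
    and d: "\<And>i. 0 \<le> d i" "\<And>i. pos i < r \<Longrightarrow> 0 < d i"
  obtains t S where "0 < t" "psd S" "trace S = (\<Sum>i\<in>UNIV. d i)" "diagonal d ** J + t *\<^sub>R M = S ** J"
proof -
  obtain A B C where A: "A\<^sup>T = A" and C: "psd C" and iA: "in_block 0 r 0 r A"
    and iB: "in_block 0 r r (q - r) B" and iC: "in_block r (q - r) r (q - r) C"
    and tr: "trace A + trace C = 0" and M: "M = (A + B ** C + (B ** C)\<^sup>T + C) ** J"
    using M unfolding block_mats_iff[OF rq q] by blast
  define H where "H = A - B ** C ** B\<^sup>T"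
  have "in_block 0 r 0 r H"
  proof -
    have "(B ** C ** B\<^sup>T) $ i $ j = 0" if "\<not> pos i < r \<or> \<not> pos j < r" for i j
    proof -
      have "B $ i $ k = 0" if "\<not> pos i < r" for i k using iB that by (auto simp: in_block_def)
      then show ?thesis using that
        by (auto simp: matrix_matrix_mult_def transpose_def sum_distrib_right intro!: sum.neutral)
    qed
    moreover have "A $ i $ j = 0" if "\<not> pos i < r \<or> \<not> pos j < r" for i j
      using iA that by (auto simp: in_block_def)
    ultimately have "pos i < r \<and> pos j < r" if "H $ i $ j \<noteq> 0" for i j
      using that unfolding H_def by (metis diff_self vector_minus_component)
    then show ?thesis by (simp add: in_block_def)
  qed
  from diagonal_dominates_block[of d r H, OF d this]
  obtain t where t: "0 < t" "\<And>x. 0 \<le> x \<bullet> (diagonal d *v x) + t * (x \<bullet> (H *v x))" by blast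
  define S where "S = diagonal d + t *\<^sub>R (A + B ** C + (B ** C)\<^sup>T + C)"
  have Csym: "C\<^sup>T = C" and Cpsd: "\<And>x. 0 \<le> x \<bullet> (C *v x)" using C by (auto simp: psd_def)
  have "0 \<le> x \<bullet> (S *v x)" for x
  proof -
    define b where "b = B\<^sup>T *v x"
    have BC: "x \<bullet> ((B ** C) *v x) = b \<bullet> (C *v x)"
      unfolding b_def matrix_vector_mul_assoc[symmetric] by (rule inner_matrix_vector)
    have BCT: "x \<bullet> ((B ** C)\<^sup>T *v x) = b \<bullet> (C *v x)"
      unfolding BC[symmetric] inner_matrix_vector[of x "B ** C"] by (rule inner_commute)
    have BCB: "x \<bullet> ((B ** C ** B\<^sup>T) *v x) = b \<bullet> (C *v b)"
      unfolding b_def matrix_vector_mul_assoc[symmetric] by (rule inner_matrix_vector)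
    have "(x + b) \<bullet> (C *v (x + b)) = x \<bullet> (C *v x) + 2 * (b \<bullet> (C *v x)) + b \<bullet> (C *v b)"
      using symmetric_inner[OF Csym, of x b]
      by (simp add: matrix_vector_right_distrib inner_add_left inner_add_right inner_commute)
    then have "x \<bullet> (S *v x) = x \<bullet> (diagonal d *v x) + t * (x \<bullet> (H *v x)) + t * ((x + b) \<bullet> (C *v (x + b)))"
      by (simp add: S_def H_def matrix_vector_mult_add_rdistrib matrix_vector_mult_diff_rdistrib
          scaleR_matrix_vector_assoc[symmetric] inner_add_right inner_diff_right BC BCT BCB algebra_simps
          del: transpose_matrix_vector)
    then show ?thesis using t(2)[of x] mult_nonneg_nonneg[OF less_imp_le[OF t(1)] Cpsd[of "x + b"]] by linarith
  qed
  moreover have "S\<^sup>T = S"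
  proof -
    have "(t *\<^sub>R N)\<^sup>T = t *\<^sub>R N\<^sup>T" for N :: "('n1, 'n1) rmat"
      by (simp add: transpose_def Finite_Cartesian_Product.vec_eq_iff)
    then show ?thesis by (simp add: S_def transpose_add A Csym add.commute add.left_commute)
  qed
  ultimately have 1: "psd S" by (simp add: psd_def)
  have 2: "trace S = (\<Sum>i\<in>UNIV. d i)"
  proof -
    have "(B ** C) $ i $ i = 0" for i
      unfolding matrix_matrix_mult_def vec_lambda_beta
      using iB iC by (intro sum.neutral ballI) (fastforce simp: in_block_def)
    then have "trace S = (\<Sum>i\<in>UNIV. d i + t * (A $ i $ i + C $ i $ i))"
      by (simp add: S_def trace_def transpose_def)
    also have "\<dots> = (\<Sum>i\<in>UNIV. d i) + t * (trace A + trace C)"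
      by (simp add: trace_def sum.distrib sum_distrib_left distrib_left)
    finally show ?thesis using tr by simp
  qed
  have 3: "diagonal d ** J + t *\<^sub>R M = S ** J"
    by (simp add: M S_def matrix_add_rdistrib matrix_scaleR_left)
  show ?thesis by (rule that[OF t(1) 1 2 3])
qed

section \<open>Directional derivatives of convex functions\<close>

lemma convex_quotient_mono:
  fixes g :: "'a::real_vector \<Rightarrow> real"
  assumes g: "convex_on UNIV g" and s: "0 < s" "s \<le> t"
  shows "(g (x + s *\<^sub>R w) - g x) / s \<le> (g (x + t *\<^sub>R w) - g x) / t"
proof -
  define l where "l = s / t"
  have l: "0 \<le> l" "l \<le> 1" "l * t = s" using s by (auto simp: l_def)
  have "x + s *\<^sub>R w = (1 - l) *\<^sub>R x + l *\<^sub>R (x + t *\<^sub>R w)"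
    by (simp add: l(3)[symmetric] algebra_simps)
  then have "g (x + s *\<^sub>R w) \<le> (1 - l) * g x + l * g (x + t *\<^sub>R w)"
    using convex_onD[OF g l(1,2), of x "x + t *\<^sub>R w"] by simp
  then have "g (x + s *\<^sub>R w) - g x \<le> (s / t) * (g (x + t *\<^sub>R w) - g x)"
    by (simp add: l_def algebra_simps)
  then show ?thesis using s by (simp add: field_simps)
qed

text \<open>
  Convexity along the line from \<open>x - w\<close> through \<open>x\<close> to \<open>x + t w\<close>.
\<close>

lemma convex_quotient_lower_bound:
  fixes g :: "'a::real_vector \<Rightarrow> real"
  assumes g: "convex_on UNIV g" and t: "0 < t"
  shows "g x - g (x - w) \<le> (g (x + t *\<^sub>R w) - g x) / t"
proof -
  define l where "l = t / (1 + t)"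
  have l: "0 \<le> l" "l \<le> 1" "(1 - l) * t = l" "1 - l = 1 / (1 + t)" using t by (auto simp: l_def field_simps)
  have "x = (1 - l) *\<^sub>R (x + t *\<^sub>R w) + l *\<^sub>R (x - w)"
    using l(3) by (simp add: algebra_simps flip: scaleR_add_left)
  then have "g x \<le> (1 - l) * g (x + t *\<^sub>R w) + l * g (x - w)"
    using convex_onD[OF g l(1,2), of "x + t *\<^sub>R w" "x - w"] by simp
  then have "g x \<le> (g (x + t *\<^sub>R w) + t * g (x - w)) / (1 + t)"
    unfolding l(4) by (simp add: l_def add_divide_distrib)
  then have "(1 + t) * g x \<le> g (x + t *\<^sub>R w) + t * g (x - w)"
    using t by (simp add: pos_le_divide_eq mult.commute)
  then show ?thesis using t by (simp add: field_simps)
qed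

text \<open>
  The difference quotients are monotone in \<open>t\<close> and bounded below, so the limit in the definition
  exists and is their infimum.
\<close>

lemma dir_deriv_convex:
  fixes g :: "'a::real_vector \<Rightarrow> real"
  assumes g: "convex_on UNIV g"
  shows "dir_deriv g x w = (INF t\<in>{0<..}. (g (x + t *\<^sub>R w) - g x) / t)"
proof -
  define q where "q t = (g (x + t *\<^sub>R w) - g x) / t" for t
  define L where "L = (INF t\<in>{0<..}. q t)"
  have bdd: "bdd_below (q ` {0<..})"
    using convex_quotient_lower_bound[OF g] by (auto intro!: bdd_belowI2 simp: q_def)
  have lower: "L \<le> q t" if "0 < t" for t
    unfolding L_def by (rule cINF_lower[OF bdd]) (use that in simp)
  have "(q \<longlongrightarrow> L) (at_right 0)"
  proof (rule order_tendstoI)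
    fix a assume "a < L"
    then show "eventually (\<lambda>t. a < q t) (at_right 0)"
      using lower by (intro eventually_at_rightI[of 0 1]) (auto intro: less_le_trans)
  next
    fix a assume "L < a"
    then obtain t where t: "0 < t" "q t < a"
      unfolding L_def using cINF_less_iff[OF _ bdd] by auto
    have "q s < a" if "s \<in> {0<..<t}" for s
      using convex_quotient_mono[OF g, of s t x w] that t by (simp add: q_def)
    then show "eventually (\<lambda>t. q t < a) (at_right 0)"
      using t(1) by (intro eventually_at_rightI[of 0 t]) auto
  qed
  then have "dir_deriv g x w = L"
    unfolding dir_deriv_def q_def[symmetric] by (intro tendsto_Lim) auto
  then show ?thesis by (simp add: L_def q_def)
qed

lemma dir_deriv_le_quotient:
  fixes g :: "'a::real_vector \<Rightarrow> real"
  assumes g: "convex_on UNIV g" and t: "0 < t"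
  shows "dir_deriv g x w \<le> (g (x + t *\<^sub>R w) - g x) / t"
  unfolding dir_deriv_convex[OF g]
  using t convex_quotient_lower_bound[OF g] by (intro cINF_lower) (auto intro!: bdd_belowI2)

lemma dir_deriv_less_imp_quotient_less:
  fixes g :: "'a::real_vector \<Rightarrow> real"
  assumes g: "convex_on UNIV g" and a: "dir_deriv g x w < a"
  obtains t where "0 < t" "t < 1" "(g (x + t *\<^sub>R w) - g x) / t < a"
proof -
  have "bdd_below ((\<lambda>t. (g (x + t *\<^sub>R w) - g x) / t) ` {0<..})"
    using convex_quotient_lower_bound[OF g] by (auto intro!: bdd_belowI2)
  then obtain t where t: "0 < t" "(g (x + t *\<^sub>R w) - g x) / t < a"
    using a unfolding dir_deriv_convex[OF g] by (subst (asm) cINF_less_iff) auto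
  have "(g (x + min t (1/2) *\<^sub>R w) - g x) / min t (1/2) \<le> (g (x + t *\<^sub>R w) - g x) / t"
    using t(1) by (intro convex_quotient_mono[OF g]) auto
  then show ?thesis using t by (intro that[of "min t (1/2)"]) auto
qed

section \<open>The descent cone\<close>

lemma descent_cone_iff:
  "W \<in> descent_cone X0 \<longleftrightarrow> (\<exists>t>0. nuclear_norm (X0 + t *\<^sub>R W) \<le> nuclear_norm X0)"
proof
  assume "W \<in> descent_cone X0"
  then obtain a X where W: "W = a *\<^sub>R (X - X0)" "0 \<le> a" "nuclear_norm X \<le> nuclear_norm X0"
    unfolding descent_cone_def cone_hull_expl by blast
  show "\<exists>t>0. nuclear_norm (X0 + t *\<^sub>R W) \<le> nuclear_norm X0"
  proof (cases "a = 0")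
    case True
    then show ?thesis using W by (intro exI[of _ 1]) simp
  next
    case False
    then show ?thesis using W by (intro exI[of _ "1 / a"]) simp
  qed
next
  assume "\<exists>t>0. nuclear_norm (X0 + t *\<^sub>R W) \<le> nuclear_norm X0"
  then obtain t where t: "0 < t" "nuclear_norm (X0 + t *\<^sub>R W) \<le> nuclear_norm X0" by blast
  then have "W = (1 / t) *\<^sub>R ((X0 + t *\<^sub>R W) - X0)" "0 \<le> 1 / t" by auto
  with t(2) show "W \<in> descent_cone X0"
    unfolding descent_cone_def cone_hull_expl by blast
qed

text \<open>
  For fixed \<open>t\<close>, strict decrease is an open condition on \<open>W\<close> by continuity of the nuclear norm, and
  it makes a difference quotient, hence the directional derivative, nonpositive.
\<close>

lemma strict_descent_imp_interior_critical:
  fixes X0 :: "('n1::{finite,linorder}, 'n2::{finite,linorder}) rmat"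
  assumes n: "CARD('n1) \<le> CARD('n2)" and t: "0 < t" "nuclear_norm (X0 + t *\<^sub>R W) < nuclear_norm X0"
  shows "W \<in> interior (critical_cone X0)"
proof (rule interiorI)
  let ?S = "{W. nuclear_norm (X0 + t *\<^sub>R W) < nuclear_norm X0}"
  have "continuous_on UNIV (nuclear_norm :: ('n1, 'n2) rmat \<Rightarrow> real)"
    by (rule convex_on_continuous[OF open_UNIV nuclear_norm_convex[OF n]])
  then have "continuous_on UNIV (\<lambda>W. nuclear_norm (X0 + t *\<^sub>R W))"
    by (rule continuous_on_compose2) (auto intro!: continuous_intros)
  then show "open ?S" by (intro open_Collect_less continuous_intros)
  show "W \<in> ?S" using t by simp
  show "?S \<subseteq> critical_cone X0"
  proof
    fix W' assume "W' \<in> ?S"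
    then have "(nuclear_norm (X0 + t *\<^sub>R W') - nuclear_norm X0) / t \<le> 0"
      using t(1) by (simp add: divide_le_0_iff)
    with dir_deriv_le_quotient[OF nuclear_norm_convex[OF n] t(1), of X0 W']
    show "W' \<in> critical_cone X0" by (simp add: critical_cone_def)
  qed
qed

text \<open>
  For \<open>X0 \<noteq> 0\<close> an interior point \<open>W\<close> of the critical cone lies strictly between a critical direction
  \<open>W'\<close> and the direction \<open>- X0\<close>, along which the norm decreases at rate \<open>nuclear_norm X0\<close>.  This gain
  absorbs the error with which a difference quotient at \<open>W'\<close> exceeds its nonpositive limit.  For
  \<open>X0 = 0\<close> the critical cone is \<open>{0}\<close>, whose interior is empty.
\<close>

lemma interior_critical_imp_descent:
  fixes X0 :: "('n1::{finite,linorder}, 'n2::{finite,linorder}) rmat"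
  assumes n: "CARD('n1) \<le> CARD('n2)" and W: "W \<in> interior (critical_cone X0)"
  shows "W \<in> descent_cone X0"
proof (cases "X0 = 0")
  case True
  have "critical_cone X0 \<subseteq> {0}"
  proof
    fix W' assume "W' \<in> critical_cone X0"
    moreover have "(\<lambda>t. (nuclear_norm (X0 + t *\<^sub>R W') - nuclear_norm X0) / t) ` {0<..} = {nuclear_norm W'}"
      using True by (auto simp: nuclear_norm_scale[OF n] nuclear_norm_0[OF n] image_iff intro!: exI[of _ 1])
    ultimately have "nuclear_norm W' \<le> 0"
      by (simp add: critical_cone_def dir_deriv_convex[OF nuclear_norm_convex[OF n]])
    then show "W' \<in> {0}"
      using nuclear_norm_nonneg[OF n, of W'] nuclear_norm_eq_0[OF n, of W'] by simp
  qed
  then have "interior (critical_cone X0) \<subseteq> interior {0}" by (rule interior_mono)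
  also have "\<dots> = {}" by (rule interior_singleton)
  finally show ?thesis using W by blast
next
  case False
  then have pos: "0 < nuclear_norm X0"
    using nuclear_norm_nonneg[OF n, of X0] nuclear_norm_eq_0[OF n, of X0] by fastforce
  obtain e where e: "0 < e" "cball W e \<subseteq> critical_cone X0"
    using W by (auto simp: mem_interior_cball)
  \<comment> \<open>The 1 keeps the denominator positive when \<open>W = - X0\<close>.\<close>
  define k where "k = e / (norm (W + X0) + 1)"
  have k: "0 < k" using e(1) by (simp add: k_def add_nonneg_pos)
  define W' where "W' = W + k *\<^sub>R (W + X0)"
  have "norm (k *\<^sub>R (W + X0)) \<le> e"
  proof -
    have "norm (k *\<^sub>R (W + X0)) = k * norm (W + X0)" using k by simp
    also have "\<dots> \<le> k * (norm (W + X0) + 1)" using k by simp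
    also have "\<dots> = e" using add_nonneg_pos[of "norm (W + X0)" 1] by (simp add: k_def)
    finally show ?thesis .
  qed
  then have "W' \<in> critical_cone X0"
    using e(2) by (auto simp: W'_def dist_norm subset_iff)
  then have "dir_deriv nuclear_norm X0 W' < k * nuclear_norm X0"
    using k pos by (simp add: critical_cone_def) (meson mult_pos_pos order_le_less_trans)
  then obtain t where t: "0 < t" "t < 1"
    "(nuclear_norm (X0 + t *\<^sub>R W') - nuclear_norm X0) / t < k * nuclear_norm X0"
    using dir_deriv_less_imp_quotient_less[OF nuclear_norm_convex[OF n]] by metis
  then have less: "nuclear_norm (X0 + t *\<^sub>R W') < nuclear_norm X0 + t * (k * nuclear_norm X0)"
    by (simp add: field_simps)
  \<comment> \<open>\<open>X0 + t W\<close> is a convex combination of \<open>X0 + t W'\<close> and \<open>(1 - t) X0\<close> with weights \<open>1 / (1 + k)\<close> and \<open>k / (1 + k)\<close>.\<close>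
  have eq: "(1 + k) *\<^sub>R (X0 + t *\<^sub>R W) = (X0 + t *\<^sub>R W') + (k * (1 - t)) *\<^sub>R X0"
    by (simp add: W'_def algebra_simps)
  have "(1 + k) * nuclear_norm (X0 + t *\<^sub>R W) = nuclear_norm ((1 + k) *\<^sub>R (X0 + t *\<^sub>R W))"
    using k by (simp add: nuclear_norm_scale[OF n])
  also have "\<dots> \<le> nuclear_norm (X0 + t *\<^sub>R W') + nuclear_norm ((k * (1 - t)) *\<^sub>R X0)"
    unfolding eq by (rule nuclear_norm_triangle[OF n])
  also have "\<dots> \<le> nuclear_norm X0 + t * (k * nuclear_norm X0) + k * (1 - t) * nuclear_norm X0"
    using less k t by (simp add: nuclear_norm_scale[OF n])
  also have "\<dots> = (1 + k) * nuclear_norm X0" by (simp add: algebra_simps)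
  finally have "nuclear_norm (X0 + t *\<^sub>R W) \<le> nuclear_norm X0"
    using k by simp
  with t(1) show ?thesis by (auto simp: descent_cone_iff)
qed

text \<open>
  For a small step the perturbed matrix is still positive semidefinite in the singular frame of \<open>X0\<close>,
  so its nuclear norm is a trace, and the trace condition keeps it constant.
\<close>

lemma block_mats_imp_descent:
  fixes X0 :: "('n1::{finite,linorder}, 'n2::{finite,linorder}) rmat"
  assumes n: "CARD('n1) \<le> CARD('n2)" and svd: "is_svd U V d X0"
    and q: "rank X0 \<le> q" "q \<le> CARD('n1)" and M: "M \<in> block_mats (rank X0) q"
  shows "U ** M ** V\<^sup>T \<in> descent_cone X0"
proof -
  have "0 < d i" if "pos i < rank X0" for i
    using svd_nonzero_iff[OF n svd, of i] that is_svdD(4)[OF svd, of i] by simp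
  from block_mats_perturbation_psd[of "rank X0" q M d, OF q M is_svdD(4)[OF svd] this]
  obtain t S where t: "0 < t" and S: "psd S" "trace S = (\<Sum>i\<in>UNIV. d i)" "diagonal d ** J + t *\<^sub>R M = S ** J"
    by blast
  have "X0 + t *\<^sub>R (U ** M ** V\<^sup>T) = U ** (diagonal d ** J + t *\<^sub>R M) ** V\<^sup>T"
    using is_svdD(5)[OF svd]
    by (simp add: matrix_add_ldistrib matrix_add_rdistrib matrix_scaleR_left matrix_scaleR_right)
  then have "nuclear_norm (X0 + t *\<^sub>R (U ** M ** V\<^sup>T)) = trace S"
    using nuclear_norm_psd[OF n S(1) is_svdD(1,2)[OF svd]] by (simp only: S(3))
  then have "nuclear_norm (X0 + t *\<^sub>R (U ** M ** V\<^sup>T)) \<le> nuclear_norm X0"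
    using S(2) nuclear_norm_svd[OF n svd] by simp
  with t show ?thesis by (auto simp: descent_cone_iff)
qed

text \<open>
  If a contraction diagonal in the singular frame of \<open>X0\<close> attains the nuclear norm at \<open>X0 + t W\<close>,
  then that matrix is a padded Gram matrix in this frame.  Subtracting \<open>X0\<close> leaves a matrix of block
  form, and equality of the norms gives the trace condition.
\<close>

lemma norming_imp_block_mats:
  fixes X0 :: "('n1::{finite,linorder}, 'n2::{finite,linorder}) rmat"
  assumes n: "CARD('n1) \<le> CARD('n2)" and svd: "is_svd U V d X0"
    and q: "rank X0 \<le> q" "q \<le> CARD('n1)"
    and c: "\<And>i. 0 \<le> c i" "\<And>i. c i \<le> 1" "\<And>i. q \<le> pos i \<Longrightarrow> c i \<noteq> 1"
    and t: "0 < t" and eq: "nuclear_norm (X0 + t *\<^sub>R W) = nuclear_norm X0"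
    and norming: "(U ** (diagonal c ** J) ** V\<^sup>T) \<bullet> (X0 + t *\<^sub>R W) = nuclear_norm (X0 + t *\<^sub>R W)"
  obtains M where "M \<in> block_mats (rank X0) q" "W = U ** M ** V\<^sup>T"
proof -
  note U = is_svdD(1)[OF svd] and V = is_svdD(2)[OF svd]
  have UU: "U ** U\<^sup>T = mat 1" "U\<^sup>T ** U = mat 1" and VV: "V ** V\<^sup>T = mat 1" "V\<^sup>T ** V = mat 1"
    using U V by (auto simp: orthogonal_matrix_def)
  define N where "N = U\<^sup>T ** (X0 + t *\<^sub>R W) ** V"
  have "U ** N ** V\<^sup>T = (U ** U\<^sup>T) ** (X0 + t *\<^sub>R W) ** (V ** V\<^sup>T)"
    by (simp only: N_def matrix_mul_assoc)
  then have N: "X0 + t *\<^sub>R W = U ** N ** V\<^sup>T" by (simp add: UU VV)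
  have nN: "nuclear_norm N = nuclear_norm X0"
    using eq unfolding N nuclear_norm_orthogonal_conj[OF n U V] .
  have "(diagonal c ** J) \<bullet> N = nuclear_norm N"
    using norming unfolding N nuclear_norm_orthogonal_conj[OF n U V] inner_orthogonal_conj[OF U V] .
  from norming_diagonal_imp_gram[OF n c(1,2) this]
  obtain w :: "'n1 \<Rightarrow> (real, 'n1) Finite_Cartesian_Product.vec" where w: "N = gram w ** J" "\<And>i. c i \<noteq> 1 \<Longrightarrow> w i = 0"
    by blast
  define S where "S = (1 / t) *\<^sub>R (gram w - diagonal d)"
  have "trace (gram w) = nuclear_norm N"
    using nuclear_norm_psd[OF n psd_gram[of w] orthogonal_matrix_id orthogonal_matrix_id] by (simp add: w(1))
  moreover have "trace (diagonal d) = nuclear_norm X0"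
    by (simp add: trace_def nuclear_norm_svd[OF n svd])
  ultimately have "trace S = 0"
    using nN by (simp add: S_def trace_def sum_subtractf flip: sum_divide_distrib)
  moreover have "d i = 0" if "rank X0 \<le> pos i" for i
    using svd_nonzero_iff[OF n svd, of i] that by simp
  ultimately have M: "S ** J \<in> block_mats (rank X0) q"
    using w(2) c(3) by (intro gram_minus_diagonal_block_mats[OF q t _ _ S_def]) auto
  have "t *\<^sub>R W = U ** N ** V\<^sup>T - X0" using N by (simp add: algebra_simps)
  also have "\<dots> = U ** (N - diagonal d ** J) ** V\<^sup>T"
    using is_svdD(5)[OF svd] by (simp add: matrix_diff_ldistrib matrix_diff_rdistrib)
  also have "N - diagonal d ** J = t *\<^sub>R (S ** J)"
    using t by (simp add: w(1) S_def matrix_scaleR_left matrix_diff_rdistrib)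
  also have "U ** (t *\<^sub>R (S ** J)) ** V\<^sup>T = t *\<^sub>R (U ** (S ** J) ** V\<^sup>T)"
    by (simp only: matrix_scaleR_left matrix_scaleR_right)
  finally have "W = U ** (S ** J) ** V\<^sup>T" using t by simp
  with M show ?thesis by (rule that)
qed

text \<open>
  A full frame \<open>P J Q\<^sup>T\<close> that attains the nuclear norm of \<open>X\<close> can be rotated into singular vectors of
  \<open>X\<close>.  This is what makes the pair \<open>(U, V)\<close> in \<open>E_set\<close> available.
\<close>

lemma svd_of_normed_frame:
  fixes X :: "('n1::{finite,linorder}, 'n2::{finite,linorder}) rmat"
  assumes n: "CARD('n1) \<le> CARD('n2)" and P: "orthogonal_matrix P" and Q: "orthogonal_matrix Q"
    and norming: "(P ** J ** Q\<^sup>T) \<bullet> X = nuclear_norm X"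
  obtains U V d where "is_svd U V d X" "U ** J ** V\<^sup>T = P ** J ** Q\<^sup>T"
proof -
  define N where "N = P\<^sup>T ** X ** Q"
  have "P ** N ** Q\<^sup>T = (P ** P\<^sup>T) ** X ** (Q ** Q\<^sup>T)"
    by (simp only: N_def matrix_mul_assoc)
  then have X: "X = P ** N ** Q\<^sup>T" using P Q by (simp add: orthogonal_matrix_def)
  have "(diagonal (\<lambda>_. 1) ** J) \<bullet> N = nuclear_norm N"
    using norming unfolding X nuclear_norm_orthogonal_conj[OF n P Q] inner_orthogonal_conj[OF P Q]
    by (simp add: diagonal_one)
  then obtain w :: "'n1 \<Rightarrow> (real, 'n1) Finite_Cartesian_Product.vec" where w: "N = gram w ** J"
    using norming_diagonal_imp_gram[OF n, of "\<lambda>_. 1" N] by auto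
  obtain U V d where "is_svd U V d (P ** (gram w ** J) ** Q\<^sup>T)" "U ** J ** V\<^sup>T = P ** J ** Q\<^sup>T"
    using svd_of_psd[OF n psd_gram[of w] P Q] by metis
  with that show ?thesis unfolding X w by blast
qed

text \<open>
  If no step along \<open>W\<close> strictly decreases the norm, then the norm is constant on the segment from
  \<open>X0\<close> to \<open>X0 + t W\<close>.  A contraction that attains the norm at the midpoint is bounded by the norm at
  both ends and averages to it, so it attains the norm at both ends.
\<close>

lemma descent_cone_subset:
  fixes X0 :: "('n1::{finite,linorder}, 'n2::{finite,linorder}) rmat"
  assumes n: "CARD('n1) \<le> CARD('n2)" and W: "W \<in> descent_cone X0"
  shows "W \<in> E_set X0 \<union> interior (critical_cone X0)"
proof (cases "\<exists>t>0. nuclear_norm (X0 + t *\<^sub>R W) < nuclear_norm X0")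
  case True
  then show ?thesis using strict_descent_imp_interior_critical[OF n] by blast
next
  case False
  obtain t where t: "0 < t" "nuclear_norm (X0 + t *\<^sub>R W) \<le> nuclear_norm X0"
    using W unfolding descent_cone_iff by blast
  have eq: "nuclear_norm (X0 + t *\<^sub>R W) = nuclear_norm X0"
    using t False by force
  define X1 where "X1 = X0 + (t / 2) *\<^sub>R W"
  have mid: "2 *\<^sub>R X1 = X0 + (X0 + t *\<^sub>R W)"
    by (simp add: X1_def algebra_simps scaleR_2)
  have X1: "nuclear_norm X0 \<le> nuclear_norm X1"
    using False t(1) unfolding X1_def by (metis half_gt_zero linorder_not_le)
  obtain P Q where PQ: "orthogonal_matrix P" "orthogonal_matrix Q" "(P ** J ** Q\<^sup>T) \<bullet> X1 = nuclear_norm X1"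
    by (rule nuclear_norm_attained[OF n, of X1])
  define Z where "Z = P ** J ** Q\<^sup>T"
  have "contraction Z" unfolding Z_def by (rule contraction_svd_frame[OF n PQ(1,2)])
  then have le: "Z \<bullet> X \<le> nuclear_norm X" for X
    by (rule contraction_inner_le_nuclear_norm[OF n])
  have "Z \<bullet> X0 + Z \<bullet> (X0 + t *\<^sub>R W) = 2 * nuclear_norm X1"
    using PQ(3) unfolding inner_add_right[symmetric] mid[symmetric] by (simp add: Z_def)
  with X1 le[of X0] le[of "X0 + t *\<^sub>R W"] eq
  have Z: "Z \<bullet> X0 = nuclear_norm X0" "Z \<bullet> (X0 + t *\<^sub>R W) = nuclear_norm (X0 + t *\<^sub>R W)" by linarith+
  obtain U V d where svd: "is_svd U V d X0" and UV: "U ** J ** V\<^sup>T = Z"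
    using svd_of_normed_frame[OF n PQ(1,2) Z(1)[unfolded Z_def]] unfolding Z_def by metis
  have rank: "rank X0 \<le> CARD('n1)" using rank_bound[of X0] by simp
  have "(U ** (diagonal (\<lambda>_. 1) ** J) ** V\<^sup>T) \<bullet> (X0 + t *\<^sub>R W) = nuclear_norm (X0 + t *\<^sub>R W)"
    using Z(2) by (simp add: diagonal_one UV)
  then obtain M where "M \<in> block_mats (rank X0) CARD('n1)" "W = U ** M ** V\<^sup>T"
    using norming_imp_block_mats[OF n svd rank order_refl, of "\<lambda>_. 1" t W] t(1) eq
    by (metis leD order_refl pos_less_card zero_le_one)
  moreover have "(U, V) \<in> ortho_pairs X0" using svd ortho_pairs_iff_svd[OF n] by blast
  ultimately show ?thesis unfolding E_set_def by blast
qed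

section \<open>Dual certificates\<close>

lemma nuclear_subgradient_norming:
  fixes X0 :: "('n1::{finite,linorder}, 'n2::{finite,linorder}) rmat"
  assumes n: "CARD('n1) \<le> CARD('n2)" and Y: "Y \<in> subdifferential nuclear_norm X0"
  shows "Y \<bullet> X0 = nuclear_norm X0" "Y \<bullet> Z \<le> nuclear_norm Z"
proof -
  have sub: "nuclear_norm X0 + Y \<bullet> (Z - X0) \<le> nuclear_norm Z" for Z
    using Y by (simp add: subdifferential_def)
  show "Y \<bullet> Z \<le> nuclear_norm Z" for Z
    using sub[of "X0 + Z"] nuclear_norm_triangle[OF n, of X0 Z] by simp
  from this[of X0] show "Y \<bullet> X0 = nuclear_norm X0"
    using sub[of 0] by (simp add: nuclear_norm_0[OF n])
qed

text \<open>
  Testing \<open>Y\<close> against the rank-one matrix of a singular pair, whose nuclear norm is at most 1, bounds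
  the singular values of \<open>Y\<close> by 1.  Since the frame is shared, \<open>Y \<bullet> X0 = \<Sum> c k * d k\<close>, and
  \<open>Y \<bullet> X0 = \<Sum> d k\<close> forces \<open>c k = 1\<close> wherever \<open>d k \<noteq> 0\<close>.
\<close>

lemma subgradient_singular_values:
  fixes X0 :: "('n1::{finite,linorder}, 'n2::{finite,linorder}) rmat"
  assumes n: "CARD('n1) \<le> CARD('n2)" and Y: "Y \<in> subdifferential nuclear_norm X0"
    and svdX: "is_svd U V d X0" and svdY: "is_svd U V c Y"
  shows "c i \<le> 1" "pos i < rank X0 \<Longrightarrow> c i = 1"
proof -
  note U = is_svdD(1)[OF svdX] and V = is_svdD(2)[OF svdX]
  have le: "c i \<le> 1" for i
  proof -
    \<comment> \<open>The matrix \<open>U (diag(e) J) V\<^sup>T\<close> is the rank-one matrix of the singular pair with index \<open>i\<close>.\<close>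
    define e where "e k = (if k = i then 1 else 0 :: real)" for k
    define u v where "u = column i U" and "v = column (of_pos (pos i)) V"
    have uv: "norm u = 1" "norm v = 1" by (auto simp: u_def v_def norm_column_orthogonal U V)
    have E: "U ** (diagonal e ** J) ** V\<^sup>T = outer u v"
      unfolding svd_outer[OF n] e_def u_def v_def
      by (simp add: if_distrib[of "\<lambda>x. x *\<^sub>R _"] cong: if_cong)
    have "c i = (\<Sum>k\<in>UNIV. c k * e k)"
      by (simp add: e_def if_distrib[of "\<lambda>x. _ * x"] cong: if_cong)
    also have "\<dots> = Y \<bullet> outer u v"
      unfolding E[symmetric] is_svdD(5)[OF svdY] inner_orthogonal_conj[OF U V] inner_rect_id_diagonal[OF n] ..
    also have "\<dots> \<le> nuclear_norm (outer u v)" by (rule nuclear_subgradient_norming(2)[OF n Y])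
    also have "\<dots> \<le> 1"
    proof -
      obtain P Q where PQ: "orthogonal_matrix P" "orthogonal_matrix Q"
        "(P ** J ** Q\<^sup>T) \<bullet> outer u v = nuclear_norm (outer u v)"
        by (rule nuclear_norm_attained[OF n, of "outer u v"])
      show ?thesis
        unfolding PQ(3)[symmetric] inner_outer
        by (rule inner_contraction_le_1[OF contraction_svd_frame[OF n PQ(1,2)] uv])
    qed
    finally show ?thesis .
  qed
  show "c i \<le> 1" by (rule le)
  have "(\<Sum>k\<in>UNIV. c k * d k) = (\<Sum>k\<in>UNIV. d k)"
    using nuclear_subgradient_norming(1)[OF n Y]
    unfolding nuclear_norm_svd[OF n svdX] unfolding is_svdD(5)[OF svdX] is_svdD(5)[OF svdY]
      inner_orthogonal_conj[OF U V] inner_rect_id_diagonal[OF n] .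
  then have "(\<Sum>k\<in>UNIV. d k * (1 - c k)) = 0"
    by (simp add: right_diff_distrib sum_subtractf mult.commute)
  moreover have "0 \<le> d k * (1 - c k)" for k
    using le is_svdD(4)[OF svdX] by simp
  ultimately have "d i * (1 - c i) = 0"
    by (subst (asm) sum_nonneg_eq_0_iff) auto
  then show "pos i < rank X0 \<Longrightarrow> c i = 1"
    using svd_nonzero_iff[OF n svdX, of i] by simp
qed

lemma unit_count_svd:
  fixes Y :: "('n1::{finite,linorder}, 'n2::{finite,linorder}) rmat"
  assumes n: "CARD('n1) \<le> CARD('n2)" and svd: "is_svd U V c Y" and c: "\<And>i. c i \<le> 1"
  shows "c i = 1 \<longleftrightarrow> pos i < unit_count Y"
proof -
  have "{k. k < CARD('n1) \<and> singular_values Y ! k = 1} = pos ` {i :: 'n1. c i = 1}"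
  proof (intro subset_antisym subsetI)
    fix k assume k: "k \<in> {k. k < CARD('n1) \<and> singular_values Y ! k = 1}"
    then have "k < CARD('n1)" "singular_values Y ! k = 1" by auto
    then have "c (of_pos k) = 1" by (simp add: singular_values_svd[OF n svd])
    with k show "k \<in> pos ` {i :: 'n1. c i = 1}"
      by (intro image_eqI[of _ _ "of_pos k"]) auto
  qed (auto simp: singular_values_svd[OF n svd])
  then have "unit_count Y = card {i. c i = 1}"
    unfolding unit_count_def by (simp add: card_image inj_on_def)
  moreover have "j \<in> {i. c i = 1}" if "i \<in> {i. c i = 1}" "j \<le> i" for i j
    using that antimonoD[OF is_svdD(3)[OF svd] that(2)] c[of j] by simp
  then have "i \<in> {i. c i = 1} \<longleftrightarrow> pos i < card {i. c i = 1}"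
    by (rule card_down_closed_pos)
  ultimately show ?thesis by simp
qed

text \<open>
  On the kernel of \<open>\<Phi>\<close> optimality excludes strict decrease, and \<open>Y\<close> is orthogonal to the kernel
  because it lies in the range of the adjoint.  Hence \<open>Y\<close> itself attains the norm at
  \<open>X0 + t W\<close>, and its singular values below 1 cut the block form down to the size \<open>unit_count Y\<close>.
\<close>

lemma descent_in_kernel:
  fixes X0 :: "('n1::{finite,linorder}, 'n2::{finite,linorder}) rmat" and \<Phi> :: "('n1, 'n2) rmat \<Rightarrow> real^'m"
  assumes n: "CARD('n1) \<le> CARD('n2)" and lin: "linear \<Phi>" and opt: "is_optimal \<Phi> M0 X0"
    and Y: "Y \<in> dual_cert_set \<Phi> X0" and UV: "(U, V) \<in> ortho_pairs X0" "(U, V) \<in> ortho_pairs Y"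
  shows "Ker \<Phi> \<inter> descent_cone X0 =
    Ker \<Phi> \<inter> {U ** M ** V\<^sup>T | M. M \<in> block_mats (rank X0) (unit_count Y)}"
proof -
  obtain d c where svdX: "is_svd U V d X0" and svdY: "is_svd U V c Y"
    using UV unfolding ortho_pairs_iff_svd[OF n] by blast
  obtain y where y: "Y = adjoint \<Phi> y" and sub: "Y \<in> subdifferential nuclear_norm X0"
    using Y unfolding dual_cert_set_def by blast
  note c = subgradient_singular_values[OF n sub svdX svdY]
  note unit = unit_count_svd[OF n svdY c(1)]
  have q: "unit_count Y \<le> CARD('n1)"
    unfolding unit_count_def by (rule order_trans[OF card_mono[of "{..<CARD('n1)}"]]) auto
  have r: "rank X0 \<le> unit_count Y"
  proof (rule ccontr)
    assume "\<not> rank X0 \<le> unit_count Y"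
    then have less: "unit_count Y < rank X0" by simp
    moreover have "rank X0 \<le> CARD('n1)" using rank_bound[of X0] by simp
    ultimately have "pos (of_pos (unit_count Y) :: 'n1) = unit_count Y" by simp
    with less c(2)[of "of_pos (unit_count Y)"] unit[of "of_pos (unit_count Y)"] show False by simp
  qed
  have "\<exists>M. M \<in> block_mats (rank X0) (unit_count Y) \<and> W = U ** M ** V\<^sup>T"
    if W: "\<Phi> W = 0" "W \<in> descent_cone X0" for W
  proof -
    obtain t where t: "0 < t" "nuclear_norm (X0 + t *\<^sub>R W) \<le> nuclear_norm X0"
      using W(2) unfolding descent_cone_iff by blast
    have "\<Phi> (X0 + t *\<^sub>R W) = M0"
      using opt W(1) lin by (simp add: is_optimal_def linear_add linear_scale)
    then have eq: "nuclear_norm (X0 + t *\<^sub>R W) = nuclear_norm X0"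
      using opt t(2) by (simp add: is_optimal_def order_antisym)
    have "Y \<bullet> W = W \<bullet> adjoint \<Phi> y" by (simp add: y inner_commute)
    also have "\<dots> = 0" by (simp add: adjoint_works[OF lin] W(1))
    finally have "Y \<bullet> (X0 + t *\<^sub>R W) = nuclear_norm (X0 + t *\<^sub>R W)"
      using nuclear_subgradient_norming(1)[OF n sub] eq by (simp add: inner_add_right)
    then have norming: "(U ** (diagonal c ** J) ** V\<^sup>T) \<bullet> (X0 + t *\<^sub>R W) = nuclear_norm (X0 + t *\<^sub>R W)"
      unfolding is_svdD(5)[OF svdY, symmetric] .
    have "c i \<noteq> 1" if "unit_count Y \<le> pos i" for i using unit[of i] that by simp
    from norming_imp_block_mats[OF n svdX r q is_svdD(4)[OF svdY] c(1) this t(1) eq norming]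
    show ?thesis by metis
  qed
  moreover have "U ** M ** V\<^sup>T \<in> descent_cone X0" if "M \<in> block_mats (rank X0) (unit_count Y)" for M
    by (rule block_mats_imp_descent[OF n svdX r q that])
  ultimately show ?thesis unfolding Ker_def by blast
qed

theorem proposition4p16:
  fixes X0 :: "('n1::{finite,linorder}, 'n2::{finite,linorder}) rmat" and r :: nat
  assumes "CARD('n1) \<le> CARD('n2)"
    and "rank X0 = r"
  shows "descent_cone X0 = E_set X0 \<union> interior (critical_cone X0) \<and>
    (\<forall>(\<Phi> :: ('n1, 'n2) rmat \<Rightarrow> real^'m) M0.
       linear \<Phi> \<longrightarrow> is_optimal \<Phi> M0 X0 \<longrightarrow>
       (\<forall>Y \<in> dual_cert_set \<Phi> X0. \<forall>(U, V) \<in> ortho_pairs X0 \<inter> ortho_pairs Y.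
          Ker \<Phi> \<inter> descent_cone X0 =
          Ker \<Phi> \<inter> {U ** M ** Finite_Cartesian_Product.transpose V | M.
            M \<in> block_mats r (unit_count Y)}))"
proof (intro conjI allI impI ballI subset_antisym subsetI)
  note n = assms(1)
  fix W assume "W \<in> descent_cone X0"
  then show "W \<in> E_set X0 \<union> interior (critical_cone X0)" by (rule descent_cone_subset[OF n])
next
  note n = assms(1)
  fix W assume "W \<in> E_set X0 \<union> interior (critical_cone X0)"
  then show "W \<in> descent_cone X0"
  proof
    assume "W \<in> E_set X0"
    then obtain M U V d where "W = U ** M ** V\<^sup>T" "M \<in> block_mats (rank X0) CARD('n1)" "is_svd U V d X0"
      unfolding E_set_def ortho_pairs_iff_svd[OF n] by blast
    moreover have "rank X0 \<le> CARD('n1)" using rank_bound[of X0] by simp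
    ultimately show ?thesis using block_mats_imp_descent[OF n _ _ order_refl] by metis
  qed (rule interior_critical_imp_descent[OF n])
next
  fix \<Phi> :: "('n1, 'n2) rmat \<Rightarrow> real^'m" and M0 Y UV
  assume "linear \<Phi>" "is_optimal \<Phi> M0 X0" "Y \<in> dual_cert_set \<Phi> X0" "UV \<in> ortho_pairs X0 \<inter> ortho_pairs Y"
  then show "case UV of (U, V) \<Rightarrow> Ker \<Phi> \<inter> descent_cone X0 =
      Ker \<Phi> \<inter> {U ** M ** V\<^sup>T | M. M \<in> block_mats r (unit_count Y)}"
    using descent_in_kernel[OF assms(1), of \<Phi> M0 X0 Y] unfolding assms(2)[symmetric] by blast
qed

end
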